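(* Let $k \ge 3$. For $n \in \mathbb{N}$ and $p \in (0,1]$, let $[n]_p$ be the random subset of $[n]$ in which each element is included independently with probability $p$, and let $X=X_{k,n,p}$ be the number of arithmetic progressions of length $k$ contained in $[n]_p$. Set $\mu=\mathbb{E} X$. Given $\gamma\in(0,1)$, there are $n_0>0$ (depending only on $k$) and $c,C>0$ (depending only on $\gamma,k$) such that for all $n\ge n_0$, $(\log n)^{1/(k-1)}n^{-1/(k-1)} \le p \le 1-\gamma$ and $t \ge \sqrt{\mathrm{Var}\, X}$ we have \[ \mathbf{1}\{\mu+t \le X_{k,n,1}\}\exp\bigl(-C\Psi(t)\bigr) \le \Pr(X \ge \mu+t) \le \exp\bigl(-c\Psi(t)\bigr), \] where $\Psi(t)=\min\{t^2/\mathrm{Var}\, X,\ \sqrt{t}\log(1/p)\}$.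
   Context: An arithmetic progression of length $k$ in $[n]$ is a $k$-element subset of $[n]$ whose elements form an arithmetic progression. $X_{k,n,1}$ is the total number of such progressions in $[n]$. $\mathbf{1}\{\cdot\}$ denotes the indicator; $\log$ is the natural logarithm. *)

theory Defs
  imports "HOL-Probability.Probability"
begin

definition random_subset :: "nat \<Rightarrow> real \<Rightarrow> nat set pmf" where
  "random_subset n p =
     map_pmf (\<lambda>f. {i \<in> {1..n}. f i}) (Pi_pmf {1..n} False (\<lambda>_. bernoulli_pmf p))"

text \<open>Progressions are counted as sets, so one and its reversal are not distinguished. For
  \<open>k \<ge> 2\<close> the cardinality condition excludes the common difference \<open>d = 0\<close>.\<close>

definition arith_progs :: "nat \<Rightarrow> nat set \<Rightarrow> nat set set" where
  "arith_progs k A =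
     {S. S \<subseteq> A \<and> card S = k \<and> (\<exists>a d. S = (\<lambda>i. a + i * d) ` {..<k})}"

definition num_AP :: "nat \<Rightarrow> nat set \<Rightarrow> real" where
  "num_AP k A = real (card (arith_progs k A))"

definition mean_AP :: "nat \<Rightarrow> nat \<Rightarrow> real \<Rightarrow> real" where
  "mean_AP k n p = measure_pmf.expectation (random_subset n p) (num_AP k)"

definition var_AP :: "nat \<Rightarrow> nat \<Rightarrow> real \<Rightarrow> real" where
  "var_AP k n p = measure_pmf.variance (random_subset n p) (num_AP k)"

definition rate_AP :: "nat \<Rightarrow> nat \<Rightarrow> real \<Rightarrow> real \<Rightarrow> real" where
  "rate_AP k n p t = min (t\<^sup>2 / var_AP k n p) (sqrt t * ln (1 / p))"

end

theory Submission
  imports Defs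
begin

text \<open>
  Write \<open>m = n p ^ (k - 1)\<close>, so that \<open>m \<ge> ln n\<close>, and \<open>Y = n\<^sup>2 p ^ k\<close>; up to constants
  depending on \<open>k\<close> and \<open>\<gamma>\<close>, the mean is \<open>Y\<close> and the variance is \<open>m * Y\<close>.

  Upper bound. If the progressions contained in the random set can be thinned out to a subfamily of
  maximum degree \<open>O(m)\<close> by deleting at most \<open>t / 2\<close> of them, then a first-moment
  count of ordered lists of pairwise disjoint progressions gives a Gaussian tail. The thinning fails
  only if there are large stars, or many vertex-disjoint stars, of progressions. Two points lie in
  at most \<open>k\<^sup>2\<close> common progressions, so a vertex of high degree yields a large star, and a union
  bound over families of disjoint stars shows that they occur with probability at most
  \<open>exp (- c * sqrt t * ln (1 / p))\<close>.

  Lower bound. Either include an initial segment of length of order \<open>sqrt t\<close>, or tilt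
  \<open>p\<close> to \<open>q = p * (1 + \<theta>)\<close> such that the mean exceeds \<open>\<mu> + t\<close> by a standard deviation,
  and transfer the probability back by the Cauchy--Schwarz inequality.
\<close>

section \<open>Binomial random subsets as finite sums\<close>

text \<open>The hypothesis on \<open>p\<close> means \<open>ln n \<le> m\<close>, so the factor
  \<open>n\<close> for the choice of the centre of a star is at most \<open>exp m\<close> and
  disappears once stars have a large constant times \<open>m\<close> edges; up to constants,
  \<open>m\<close> is also the expected degree of a chosen point. The upper bound changes regime at
  \<open>t^2 = m^2 * Y\<close>, where the Gaussian exponent \<open>t^2 / (m * Y)\<close> equals
  \<open>m\<close>: below, one star of size of order \<open>m\<close> is already as unlikely as the
  claimed tail; above, the factor \<open>ln (1 / p)\<close> has to be earned from stars much larger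
  than \<open>m\<close>. The two rates fit together because of \<open>m \<le> sqrt (Y * p)\<close>,
  which is where \<open>k \<ge> 3\<close> enters. It gives
  \<open>m * ln (1 / p) \<le> 2 * sqrt Y\<close>; hence, for \<open>t\<close> at least of order
  \<mu>, including a segment costs no more than the Gaussian rate up to a constant, and tilting is
  needed only for \<open>t\<close> below a small multiple of \<mu>. Since \<open>t\<close> may equal
  one standard deviation, the exponent alone cannot absorb a constant factor in front of it;
  Cantelli's inequality supplies the missing bound 1/2.\<close>

definition bexp :: "'a set \<Rightarrow> real \<Rightarrow> ('a set \<Rightarrow> real) \<Rightarrow> real" where
  "bexp V p f = (\<Sum>A\<in>Pow V. p ^ card A * (1 - p) ^ card (V - A) * f A)"

abbreviation bprob :: "'a set \<Rightarrow> real \<Rightarrow> ('a set \<Rightarrow> bool) \<Rightarrow> real" where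
  "bprob V p Q \<equiv> bexp V p (\<lambda>A. of_bool (Q A))"

lemma bexp_mono:
  assumes "0 \<le> p" "p \<le> 1" "\<And>A. A \<subseteq> V \<Longrightarrow> f A \<le> g A"
  shows "bexp V p f \<le> bexp V p g"
  unfolding bexp_def using assms by (intro sum_mono mult_left_mono) auto

lemma bexp_cong:
  assumes "\<And>A. A \<subseteq> V \<Longrightarrow> f A = g A"
  shows "bexp V p f = bexp V p g"
  unfolding bexp_def using assms by (intro sum.cong) auto

lemma bexp_add: "bexp V p (\<lambda>A. f A + g A) = bexp V p f + bexp V p g"
  by (simp add: bexp_def algebra_simps sum.distrib)

lemma bexp_diff: "bexp V p (\<lambda>A. f A - g A) = bexp V p f - bexp V p g"
  by (simp add: bexp_def algebra_simps sum_subtractf)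

lemma bexp_cmult: "bexp V p (\<lambda>A. c * f A) = c * bexp V p f"
  by (simp add: bexp_def algebra_simps sum_distrib_left)

lemma bexp_sum: "bexp V p (\<lambda>A. \<Sum>i\<in>I. f i A) = (\<Sum>i\<in>I. bexp V p (f i))"
  unfolding bexp_def sum_distrib_left by (rule sum.swap)

lemma bprob_supset:
  assumes "finite V" "S \<subseteq> V"
  shows "bprob V p (\<lambda>A. S \<subseteq> A) = p ^ card S"
proof -
  \<comment> \<open>The condition \<open>S \<subseteq> A\<close> becomes a vanishing factor at each
    point of \<open>S\<close> outside \<open>A\<close>, so that \<open>prod_add\<close> factors the
    sum over the points.\<close>
  have "p ^ card A * (1 - p) ^ card (V - A) * of_bool (S \<subseteq> A)
      = (\<Prod>i\<in>A. p) * (\<Prod>i\<in>V - A. if i \<in> S then 0 else 1 - p)" if "A \<subseteq> V" for A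
  proof (cases "S \<subseteq> A")
    case True
    then have "(\<Prod>i\<in>V - A. if i \<in> S then 0 else 1 - p) = (\<Prod>i\<in>V - A. 1 - p)"
      by (intro prod.cong) auto
    then show ?thesis using True by simp
  next
    case False
    then obtain i where "i \<in> S" "i \<notin> A" by auto
    then have "(\<Prod>i\<in>V - A. if i \<in> S then 0 else 1 - p) = 0"
      using assms by (intro prod_zero) auto
    then show ?thesis using False by simp
  qed
  then have "bprob V p (\<lambda>A. S \<subseteq> A)
      = (\<Sum>A\<in>Pow V. (\<Prod>i\<in>A. p) * (\<Prod>i\<in>V - A. if i \<in> S then 0 else 1 - p))"
    unfolding bexp_def by (intro sum.cong) auto
  also have "\<dots> = (\<Prod>i\<in>V. p + (if i \<in> S then 0 else 1 - p))"
    using prod_add[OF assms(1), of "\<lambda>_. p" "\<lambda>i. if i \<in> S then 0 else 1 - p"] by simp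
  also have "\<dots> = (\<Prod>i\<in>V. if i \<in> S then p else 1)"
    by (intro prod.cong) auto
  also have "\<dots> = p ^ card S"
    using assms by (simp add: prod.If_cases Int_absorb1)
  finally show ?thesis .
qed

lemma bexp_const: "finite V \<Longrightarrow> bexp V p (\<lambda>_. c) = c"
  using bprob_supset[of V "{}" p] bexp_cmult[of V p c "\<lambda>_. 1"] by simp

lemma bprob_mono:
  assumes "0 \<le> p" "p \<le> 1" "\<And>A. A \<subseteq> V \<Longrightarrow> P A \<Longrightarrow> Q A"
  shows "bprob V p P \<le> bprob V p Q"
  using assms by (intro bexp_mono) auto

lemma bprob_nonneg: "0 \<le> p \<Longrightarrow> p \<le> 1 \<Longrightarrow> 0 \<le> bprob V p P"
  unfolding bexp_def by (intro sum_nonneg) auto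

lemma bprob_le_1: "finite V \<Longrightarrow> 0 \<le> p \<Longrightarrow> p \<le> 1 \<Longrightarrow> bprob V p P \<le> 1"
  using bexp_mono[of p V "\<lambda>A. of_bool (P A)" "\<lambda>_. 1"] by (simp add: bexp_const)

lemma bprob_not: "finite V \<Longrightarrow> bprob V p (\<lambda>A. \<not> P A) = 1 - bprob V p P"
  using bexp_diff[of V p "\<lambda>_. 1" "\<lambda>A. of_bool (P A)"]
  by (simp add: bexp_const of_bool_not_iff)

lemma bprob_disj:
  assumes "0 \<le> p" "p \<le> 1"
  shows "bprob V p (\<lambda>A. P A \<or> Q A) \<le> bprob V p P + bprob V p Q"
  unfolding bexp_add[symmetric] using assms by (intro bexp_mono) auto

lemma bprob_Markov:
  assumes "0 \<le> p" "p \<le> 1" "0 < c"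
    and "\<And>A. A \<subseteq> V \<Longrightarrow> 0 \<le> f A" "\<And>A. A \<subseteq> V \<Longrightarrow> Q A \<Longrightarrow> c \<le> f A"
  shows "bprob V p Q \<le> bexp V p f / c"
proof -
  have "c * bprob V p Q \<le> bexp V p f"
    unfolding bexp_cmult[symmetric] using assms by (intro bexp_mono) auto
  then show ?thesis using assms(3) by (simp add: field_simps)
qed

text \<open>Cantelli's inequality at one standard deviation; unlike Chebyshev's it is nontrivial there.\<close>

lemma bprob_Cantelli:
  assumes fin: "finite V" and p: "0 \<le> p" "p \<le> 1" and s: "0 < s"
    and var: "bexp V p (\<lambda>A. (f A - bexp V p f)\<^sup>2) \<le> s\<^sup>2"
  shows bprob_Cantelli_upper: "bprob V p (\<lambda>A. f A \<ge> bexp V p f + s) \<le> 1 / 2"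
    and bprob_Cantelli_lower: "bprob V p (\<lambda>A. f A \<ge> bexp V p f - s) \<ge> 1 / 2"
proof -
  define \<mu> where "\<mu> = bexp V p f"
  \<comment> \<open>The sign \<open>x\<close> is 1 or -1, so one computation serves both tails.
    Shifting by \<open>s\<close> before squaring gives a second moment of at most
    \<open>2 * s^2\<close> against the Markov threshold \<open>(2 * s)^2\<close>.\<close>
  have sq: "bexp V p (\<lambda>A. (x * (f A - \<mu>) + s)\<^sup>2) \<le> 2 * s\<^sup>2" if x: "x\<^sup>2 = 1" for x
  proof -
    have "bexp V p (\<lambda>A. (x * (f A - \<mu>) + s)\<^sup>2)
        = bexp V p (\<lambda>A. (f A - \<mu>)\<^sup>2 + ((2 * x * s) * (f A - \<mu>) + s\<^sup>2))"
      using x by (intro bexp_cong) (auto simp: power2_sum power_mult_distrib)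
    also have "\<dots> = bexp V p (\<lambda>A. (f A - \<mu>)\<^sup>2) + s\<^sup>2"
      unfolding bexp_add bexp_cmult bexp_diff by (simp add: bexp_const fin \<mu>_def)
    finally show ?thesis using var by (simp add: \<mu>_def)
  qed
  have up: "bprob V p (\<lambda>A. x * (f A - \<mu>) \<ge> s) \<le> 1 / 2" if x: "x\<^sup>2 = 1" for x
  proof -
    have "bprob V p (\<lambda>A. x * (f A - \<mu>) \<ge> s) \<le> bexp V p (\<lambda>A. (x * (f A - \<mu>) + s)\<^sup>2) / (s + s)\<^sup>2"
      using p s by (intro bprob_Markov power_mono) auto
    also have "\<dots> \<le> 2 * s\<^sup>2 / (s + s)\<^sup>2"
      by (intro divide_right_mono sq[OF x]) auto
    also have "\<dots> = 1 / 2" using s by (simp add: power2_eq_square)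
    finally show ?thesis .
  qed
  show "bprob V p (\<lambda>A. f A \<ge> bexp V p f + s) \<le> 1 / 2"
    using up[of 1] by (simp add: \<mu>_def algebra_simps)
  have "1 - bprob V p (\<lambda>A. - 1 * (f A - \<mu>) \<ge> s) = bprob V p (\<lambda>A. \<not> - 1 * (f A - \<mu>) \<ge> s)"
    by (rule bprob_not[OF fin, symmetric])
  also have "\<dots> \<le> bprob V p (\<lambda>A. f A \<ge> bexp V p f - s)"
    using p by (intro bprob_mono) (auto simp: \<mu>_def)
  finally show "bprob V p (\<lambda>A. f A \<ge> bexp V p f - s) \<ge> 1 / 2"
    using up[of "- 1"] by simp
qed

text \<open>One-coordinate case of the Harris inequality: given the part of the set outside
  \<open>v\<close>, the left side averages \<open>Q A\<close> and \<open>Q (insert v A)\<close>, and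
  monotonicity puts this average below the second value.\<close>

lemma bprob_insert_increasing:
  assumes fin: "finite V" and v: "v \<in> V" and p: "0 \<le> p" "p \<le> 1"
    and mono: "\<And>A. A \<subseteq> V \<Longrightarrow> Q A \<Longrightarrow> Q (insert v A)"
  shows "p * bprob V p Q \<le> bprob V p (\<lambda>A. v \<in> A \<and> Q A)"
proof -
  define U where "U = V - {v}"
  have V: "V = insert v U" and vU: "v \<notin> U" and finU: "finite U"
    using v fin by (auto simp: U_def)
  define w where "w A = p ^ card A * (1 - p) ^ card (U - A)" for A
  have split: "bexp V p g = (\<Sum>A\<in>Pow U. w A * ((1 - p) * g A + p * g (insert v A)))" for g
  proof -
    have inj: "inj_on (insert v) (Pow U)" using vU by (auto simp: inj_on_def)
    have "bexp V p g = (\<Sum>A\<in>Pow U. p ^ card A * (1 - p) ^ card (V - A) * g A)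
        + (\<Sum>A\<in>insert v ` Pow U. p ^ card A * (1 - p) ^ card (V - A) * g A)"
      unfolding bexp_def V Pow_insert using vU finU by (intro sum.union_disjoint) auto
    also have "(\<Sum>A\<in>insert v ` Pow U. p ^ card A * (1 - p) ^ card (V - A) * g A)
        = (\<Sum>A\<in>Pow U. w A * (p * g (insert v A)))"
    proof (subst sum.reindex[OF inj], intro sum.cong refl)
      fix A assume "A \<in> Pow U"
      then have "finite A" "v \<notin> A" "V - insert v A = U - A"
        using finU vU by (auto simp: V intro: finite_subset)
      then show "((\<lambda>A. p ^ card A * (1 - p) ^ card (V - A) * g A) \<circ> insert v) A
          = w A * (p * g (insert v A))"
        by (simp add: w_def)
    qed
    also have "(\<Sum>A\<in>Pow U. p ^ card A * (1 - p) ^ card (V - A) * g A)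
        = (\<Sum>A\<in>Pow U. w A * ((1 - p) * g A))"
    proof (intro sum.cong refl)
      fix A assume "A \<in> Pow U"
      then have "V - A = insert v (U - A)" "v \<notin> U - A" "finite (U - A)"
        using finU vU by (auto simp: V)
      then show "p ^ card A * (1 - p) ^ card (V - A) * g A = w A * ((1 - p) * g A)"
        by (simp add: w_def)
    qed
    finally show ?thesis by (simp add: sum.distrib distrib_left)
  qed
  have *: "p * ((1 - p) * of_bool (Q A) + p * of_bool (Q (insert v A)))
      \<le> p * of_bool (Q (insert v A))" if "A \<subseteq> U" for A
  proof -
    have "A \<subseteq> V" using that by (auto simp: V)
    then have "of_bool (Q A) \<le> (of_bool (Q (insert v A)) :: real)"
      using mono by auto
    then have "(1 - p) * of_bool (Q A) \<le> (1 - p) * (of_bool (Q (insert v A)) :: real)"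
      using p by (intro mult_left_mono) auto
    then show ?thesis using p by (intro mult_left_mono) (auto simp: algebra_simps)
  qed
  then have "w A * (p * ((1 - p) * of_bool (Q A) + p * of_bool (Q (insert v A))))
      \<le> w A * ((1 - p) * of_bool (v \<in> A \<and> Q A)
          + p * of_bool (v \<in> insert v A \<and> Q (insert v A)))" if "A \<in> Pow U" for A
  proof (intro mult_left_mono)
    have "v \<notin> A" "A \<subseteq> U" using that vU by auto
    then show "p * ((1 - p) * of_bool (Q A) + p * of_bool (Q (insert v A)))
        \<le> (1 - p) * of_bool (v \<in> A \<and> Q A) + p * of_bool (v \<in> insert v A \<and> Q (insert v A))"
      using * by simp
  qed (use p in \<open>simp add: w_def\<close>)
  then show ?thesis
    unfolding split sum_distrib_left
    by (intro sum_mono) (simp add: mult.left_commute)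
qed

text \<open>Harris inequality against the presence of \<open>S\<close>, adding its points one at a
  time. It serves the planting argument, where the rest of the count must stay typical although
  \<open>S\<close> is forced.\<close>

lemma bprob_supset_increasing:
  assumes fin: "finite V" and p: "0 \<le> p" "p \<le> 1"
    and mono: "\<And>A B. A \<subseteq> B \<Longrightarrow> B \<subseteq> V \<Longrightarrow> Q A \<Longrightarrow> Q B" and S: "S \<subseteq> V"
  shows "p ^ card S * bprob V p Q \<le> bprob V p (\<lambda>A. S \<subseteq> A \<and> Q A)"
proof -
  have "finite S" using S fin finite_subset by auto
  then show ?thesis using S
  proof (induction S)
    case empty
    then show ?case by simp
  next
    case (insert v S)
    have "p ^ card (insert v S) * bprob V p Q = p * (p ^ card S * bprob V p Q)"
      using insert by simp
    also have "\<dots> \<le> p * bprob V p (\<lambda>A. S \<subseteq> A \<and> Q A)"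
      using insert p by (intro mult_left_mono) auto
    also have "\<dots> \<le> bprob V p (\<lambda>A. v \<in> A \<and> S \<subseteq> A \<and> Q A)"
    proof (rule bprob_insert_increasing)
      show "S \<subseteq> insert v A \<and> Q (insert v A)" if "A \<subseteq> V" "S \<subseteq> A \<and> Q A" for A
        using mono[of A "insert v A"] that insert by auto
    qed (use fin insert p in auto)
    finally show ?case by (simp add: conj_assoc insert_subset)
  qed
qed

text \<open>Change of measure: Cauchy--Schwarz against the second moment of the likelihood ratio.\<close>

lemma bprob_change_measure:
  assumes fin: "finite V" and p: "0 < p" "p < 1" and q: "0 \<le> q" "q \<le> 1"
  shows "(bprob V q Q)\<^sup>2 \<le> (1 + (q - p)\<^sup>2 / (p * (1 - p))) ^ card V * bprob V p Q"
proof -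
  define w where "w r A = r ^ card A * (1 - r) ^ card (V - A)" for r :: real and A :: "'a set"
  have wp: "0 < w p A" for A using p by (simp add: w_def)
  have "bprob V q Q = (\<Sum>A\<in>Pow V. (w q A / sqrt (w p A)) * (sqrt (w p A) * of_bool (Q A)))"
    unfolding bexp_def w_def[symmetric] using wp less_imp_neq[OF wp] by (intro sum.cong) auto
  then have "(bprob V q Q)\<^sup>2 \<le> (\<Sum>A\<in>Pow V. (w q A / sqrt (w p A))\<^sup>2)
      * (\<Sum>A\<in>Pow V. (sqrt (w p A) * of_bool (Q A))\<^sup>2)"
    using Cauchy_Schwarz_ineq_sum by metis
  also have "(\<Sum>A\<in>Pow V. (sqrt (w p A) * of_bool (Q A))\<^sup>2) = bprob V p Q"
    unfolding bexp_def w_def[symmetric] using wp less_imp_le[OF wp]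
    by (intro sum.cong) (auto simp: power_mult_distrib)
  \<comment> \<open>The second moment of the likelihood ratio factors over the points; each
    contributes one plus the chi-square distance between the two Bernoulli laws.\<close>
  also have "(\<Sum>A\<in>Pow V. (w q A / sqrt (w p A))\<^sup>2)
      = (\<Sum>A\<in>Pow V. (\<Prod>i\<in>A. q\<^sup>2 / p) * (\<Prod>i\<in>V - A. (1 - q)\<^sup>2 / (1 - p)))"
    using less_imp_le[OF wp]
    by (intro sum.cong)
       (auto simp: power_divide w_def power_mult_distrib power_mult[symmetric] mult.commute)
  also have "\<dots> = (q\<^sup>2 / p + (1 - q)\<^sup>2 / (1 - p)) ^ card V"
    using prod_add[OF fin, of "\<lambda>_. q\<^sup>2 / p" "\<lambda>_. (1 - q)\<^sup>2 / (1 - p)"] by simp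
  also have "q\<^sup>2 / p + (1 - q)\<^sup>2 / (1 - p) = 1 + (q - p)\<^sup>2 / (p * (1 - p))"
    using p by (simp add: field_simps power2_eq_square)
  finally show ?thesis .
qed

section \<open>Translation from the probability mass function to finite sums\<close>

lemma pmf_random_subset:
  assumes "A \<subseteq> {1..n}" "0 \<le> p" "p \<le> 1"
  shows "pmf (random_subset n p) A = p ^ card A * (1 - p) ^ card ({1..n} - A)"
proof -
  let ?M = "Pi_pmf {1..n} False (\<lambda>_. bernoulli_pmf p)"
  have "(\<lambda>f. {i \<in> {1..n}. f i}) -` {A} = Pi {1..n} (\<lambda>i. {i \<in> A})"
    using assms by (auto simp: Pi_iff set_eq_iff)
  then have "pmf (random_subset n p) A = measure ?M (Pi {1..n} (\<lambda>i. {i \<in> A}))"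
    by (simp add: random_subset_def pmf_map)
  also have "\<dots> = (\<Prod>i\<in>{1..n}. pmf (bernoulli_pmf p) (i \<in> A))"
    by (subst measure_Pi_pmf_Pi) (simp_all add: measure_pmf_single)
  also have "\<dots> = (\<Prod>i\<in>{1..n}. if i \<in> A then p else 1 - p)"
    using assms by (intro prod.cong) auto
  also have "\<dots> = (\<Prod>i\<in>{1..n} \<inter> A. p) * (\<Prod>i\<in>{1..n} - A. 1 - p)"
    by (subst prod.If_cases) (auto simp: Diff_eq Collect_neg_eq)
  also have "\<dots> = p ^ card A * (1 - p) ^ card ({1..n} - A)"
    using assms by (simp add: Int_absorb1)
  finally show ?thesis .
qed

lemma expectation_random_subset:
  assumes "0 \<le> p" "p \<le> 1"
  shows "measure_pmf.expectation (random_subset n p) f = bexp {1..n} p f"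
proof -
  have "set_pmf (random_subset n p) \<subseteq> Pow {1..n}"
    by (auto simp: random_subset_def)
  then have "measure_pmf.expectation (random_subset n p) f
      = (\<Sum>A\<in>Pow {1..n}. pmf (random_subset n p) A * f A)"
    by (subst integral_measure_pmf[of "Pow {1..n}"]) auto
  also have "\<dots> = bexp {1..n} p f"
    unfolding bexp_def using assms by (intro sum.cong) (auto simp: pmf_random_subset)
  finally show ?thesis .
qed

lemma prob_random_subset:
  assumes "0 \<le> p" "p \<le> 1"
  shows "measure_pmf.prob (random_subset n p) {A. Q A} = bprob {1..n} p Q"
proof -
  have "measure_pmf.prob (random_subset n p) {A. Q A}
      = measure_pmf.expectation (random_subset n p) (indicator {A. Q A})"
    by simp
  also have "\<dots> = bprob {1..n} p Q"
    unfolding expectation_random_subset[OF assms]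
    by (intro bexp_cong) (auto simp: indicator_def)
  finally show ?thesis .
qed

section \<open>Disjoint edges, stars and degree reduction\<close>

text \<open>With ordered lists, each extension by one edge multiplies both the upper and the lower
  count, and no factorials arise.\<close>

fun disjoint_lists :: "'a set set \<Rightarrow> nat \<Rightarrow> 'a set list set" where
  "disjoint_lists G 0 = {[]}"
| "disjoint_lists G (Suc s) =
     (\<lambda>(l, e). e # l) ` (SIGMA l:disjoint_lists G s. {e \<in> G. \<forall>f\<in>set l. e \<inter> f = {}})"

lemma finite_disjoint_lists: "finite G \<Longrightarrow> finite (disjoint_lists G s)"
  by (induction s) auto

lemma disjoint_lists_subset: "l \<in> disjoint_lists G s \<Longrightarrow> set l \<subseteq> G \<and> length l = s"
proof (induction s arbitrary: l)
  case (Suc s)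
  then obtain e l' where "l = e # l'" "l' \<in> disjoint_lists G s" "e \<in> G" by auto
  then show ?case using Suc.IH[of l'] by simp
qed simp

lemma sum_disjoint_lists_Suc:
  assumes "finite G"
  shows "(\<Sum>l\<in>disjoint_lists G (Suc s). h l)
    = (\<Sum>l\<in>disjoint_lists G s. \<Sum>e | e \<in> G \<and> (\<forall>f\<in>set l. e \<inter> f = {}). h (e # l))"
proof -
  have "inj_on (\<lambda>(l, e). e # l) (SIGMA l:disjoint_lists G s. {e \<in> G. \<forall>f\<in>set l. e \<inter> f = {}})"
    by (auto simp: inj_on_def)
  then have "(\<Sum>l\<in>disjoint_lists G (Suc s). h l)
      = (\<Sum>(l, e)\<in>(SIGMA l:disjoint_lists G s. {e \<in> G. \<forall>f\<in>set l. e \<inter> f = {}}). h (e # l))"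
    by (simp add: sum.reindex case_prod_unfold)
  also have "\<dots> = (\<Sum>l\<in>disjoint_lists G s. \<Sum>e | e \<in> G \<and> (\<forall>f\<in>set l. e \<inter> f = {}). h (e # l))"
    using assms by (subst sum.Sigma) (auto simp: finite_disjoint_lists)
  finally show ?thesis .
qed

lemma card_Union_disjoint_lists:
  assumes "l \<in> disjoint_lists G s" "\<And>e. e \<in> G \<Longrightarrow> finite e"
  shows "finite (\<Union>(set l)) \<and> card (\<Union>(set l)) = sum_list (map card l)"
  using assms(1)
proof (induction s arbitrary: l)
  case (Suc s)
  then obtain e l' where l: "l = e # l'" "l' \<in> disjoint_lists G s" "e \<in> G"
    "\<forall>f\<in>set l'. e \<inter> f = {}" by auto
  then have "finite (\<Union>(set l'))" "card (\<Union>(set l')) = sum_list (map card l')" "e \<inter> \<Union>(set l') = {}"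
    using Suc.IH by auto
  then show ?case using l assms(2) by (simp add: card_Un_disjoint)
qed auto

lemma disjoint_lists_mono: "G \<subseteq> G' \<Longrightarrow> disjoint_lists G s \<subseteq> disjoint_lists G' s"
proof (induction s)
  case (Suc s)
  then have "(SIGMA l:disjoint_lists G s. {e \<in> G. \<forall>f\<in>set l. e \<inter> f = {}})
      \<subseteq> (SIGMA l:disjoint_lists G' s. {e \<in> G'. \<forall>f\<in>set l. e \<inter> f = {}})"
    by blast
  then show ?case by (simp only: disjoint_lists.simps image_mono)
qed simp

text \<open>Restriction to the random set commutes with forming lists, so the count inside
  \<open>A\<close> is a sum of indicators over a fixed index set.\<close>

lemma disjoint_lists_restrict:
  "disjoint_lists {e \<in> G. e \<subseteq> A} s = {l \<in> disjoint_lists G s. \<Union>(set l) \<subseteq> A}"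
proof (induction s)
  case (Suc s)
  have "(SIGMA l:disjoint_lists {e \<in> G. e \<subseteq> A} s. {e \<in> {e \<in> G. e \<subseteq> A}. \<forall>f\<in>set l. e \<inter> f = {}})
      = {(l, e) \<in> (SIGMA l:disjoint_lists G s. {e \<in> G. \<forall>f\<in>set l. e \<inter> f = {}}).
          \<Union>(set (e # l)) \<subseteq> A}"
    unfolding Suc by auto
  moreover have "(\<lambda>(l, e). e # l) ` {(l, e) \<in> B. P (e # l)} = {l \<in> (\<lambda>(l, e). e # l) ` B. P l}"
    for B :: "('a set list \<times> 'a set) set" and P
    by auto
  ultimately show ?case by (simp only: disjoint_lists.simps)
qed auto

text \<open>Disjointness makes the weights multiply; after that the condition on the next edge is
  dropped, which leaves a power.\<close>

lemma sum_power_disjoint_lists: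
  assumes fin: "finite G" "\<And>e. e \<in> G \<Longrightarrow> finite e" and p: "0 \<le> p"
  shows "(\<Sum>l\<in>disjoint_lists G s. p ^ card (\<Union>(set l))) \<le> (\<Sum>e\<in>G. p ^ card e :: real) ^ s"
proof (induction s)
  case (Suc s)
  have "(\<Sum>l\<in>disjoint_lists G (Suc s). p ^ card (\<Union>(set l)))
      = (\<Sum>l\<in>disjoint_lists G s. \<Sum>e | e \<in> G \<and> (\<forall>f\<in>set l. e \<inter> f = {}). p ^ card (\<Union>(set (e # l))))"
    by (rule sum_disjoint_lists_Suc[OF fin(1)])
  also have "\<dots> = (\<Sum>l\<in>disjoint_lists G s. \<Sum>e | e \<in> G \<and> (\<forall>f\<in>set l. e \<inter> f = {}).
      p ^ card e * p ^ card (\<Union>(set l)))"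
  proof (intro sum.cong refl)
    fix l e assume l: "l \<in> disjoint_lists G s" and e: "e \<in> {e \<in> G. \<forall>f\<in>set l. e \<inter> f = {}}"
    have "finite (\<Union>(set l))" using card_Union_disjoint_lists[OF l] fin by auto
    moreover have "e \<inter> \<Union>(set l) = {}" "finite e" using e fin by auto
    ultimately show "p ^ card (\<Union>(set (e # l))) = p ^ card e * p ^ card (\<Union>(set l))"
      by (simp add: card_Un_disjoint power_add)
  qed
  also have "\<dots> \<le> (\<Sum>l\<in>disjoint_lists G s. \<Sum>e\<in>G. p ^ card e * p ^ card (\<Union>(set l)))"
    using fin p by (intro sum_mono sum_mono2) auto
  also have "\<dots> = (\<Sum>e\<in>G. p ^ card e) * (\<Sum>l\<in>disjoint_lists G s. p ^ card (\<Union>(set l)))"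
    by (simp add: sum_distrib_left sum_distrib_right)
  also have "\<dots> \<le> (\<Sum>e\<in>G. p ^ card e) * (\<Sum>e\<in>G. p ^ card e) ^ s"
    using Suc p by (intro mult_left_mono sum_nonneg) auto
  finally show ?case by simp
qed auto

text \<open>Markov's inequality for the number of lists. With \<open>c = 1\<close> it is the union
  bound over families of disjoint stars, with a large \<open>c\<close> it yields the Gaussian
  tail.\<close>

lemma bprob_disjoint_lists:
  assumes V: "finite V" "G \<subseteq> Pow V" and p: "0 \<le> p" "p \<le> 1" and c: "0 < c"
    and Q: "\<And>A. A \<subseteq> V \<Longrightarrow> Q A \<Longrightarrow> c \<le> real (card (disjoint_lists {e \<in> G. e \<subseteq> A} s))"
  shows "bprob V p Q \<le> (\<Sum>e\<in>G. p ^ card e) ^ s / c"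
proof -
  have fin: "finite G" "\<And>e. e \<in> G \<Longrightarrow> finite e"
    using V finite_subset[of G "Pow V"] by (auto intro: finite_subset)
  have "bprob V p Q \<le> bexp V p (\<lambda>A. real (card (disjoint_lists {e \<in> G. e \<subseteq> A} s))) / c"
    using p c Q by (intro bprob_Markov) auto
  also have "bexp V p (\<lambda>A. real (card (disjoint_lists {e \<in> G. e \<subseteq> A} s)))
      = bexp V p (\<lambda>A. \<Sum>l\<in>disjoint_lists G s. of_bool (\<Union>(set l) \<subseteq> A))"
    unfolding disjoint_lists_restrict using finite_disjoint_lists[OF fin(1)]
    by (intro bexp_cong) (simp add: sum.If_cases of_bool_def Int_def)
  also have "\<dots> = (\<Sum>l\<in>disjoint_lists G s. p ^ card (\<Union>(set l)))"
    unfolding bexp_sum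
  proof (intro sum.cong refl bprob_supset V)
    fix l assume "l \<in> disjoint_lists G s"
    then show "\<Union>(set l) \<subseteq> V" using disjoint_lists_subset[of l G s] V by auto
  qed
  also have "\<dots> \<le> (\<Sum>e\<in>G. p ^ card e) ^ s"
    by (rule sum_power_disjoint_lists[OF fin p(1)])
  finally show ?thesis using c by (simp add: divide_right_mono)
qed

text \<open>Greedy extension: fewer than \<open>s\<close> edges have been chosen, each blocks at
  most \<open>C\<close> edges of \<open>J\<close>, so at least \<open>x\<close> candidates remain
  for the next place.\<close>

lemma card_disjoint_lists_ge:
  assumes fin: "finite J" and x: "0 \<le> x" "x \<le> real (card J) - real s * C" and C: "0 \<le> C"
    and deg: "\<And>e. e \<in> J \<Longrightarrow> real (card {f \<in> J. f \<inter> e \<noteq> {}}) \<le> C" and "j \<le> s"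
  shows "x ^ j \<le> real (card (disjoint_lists J j))"
  using \<open>j \<le> s\<close>
proof (induction j)
  case (Suc j)
  have ext: "x \<le> (\<Sum>e | e \<in> J \<and> (\<forall>f\<in>set l. e \<inter> f = {}). 1)" if l: "l \<in> disjoint_lists J j" for l
  proof -
    let ?K = "{e \<in> J. \<forall>f\<in>set l. e \<inter> f = {}}"
    have l': "set l \<subseteq> J" "length l = j" using disjoint_lists_subset[OF l] by auto
    have "J - ?K \<subseteq> (\<Union>f\<in>set l. {e \<in> J. e \<inter> f \<noteq> {}})" by auto
    then have "card (J - ?K) \<le> card (\<Union>f\<in>set l. {e \<in> J. e \<inter> f \<noteq> {}})"
      using fin by (intro card_mono) auto
    also have "\<dots> \<le> (\<Sum>f\<in>set l. card {e \<in> J. e \<inter> f \<noteq> {}})"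
      by (rule card_UN_le) simp
    finally have "real (card (J - ?K)) \<le> (\<Sum>f\<in>set l. real (card {e \<in> J. e \<inter> f \<noteq> {}}))"
      by (simp flip: of_nat_sum)
    also have "\<dots> \<le> (\<Sum>f\<in>set l. C)"
      using deg l' by (intro sum_mono) auto
    also have "\<dots> \<le> real s * C"
      using card_length[of l] l' Suc.prems C by (auto intro!: mult_right_mono)
    finally have "real (card (J - ?K)) \<le> real s * C" .
    moreover have "card J = card (J - ?K) + card ?K"
      using fin card_Diff_subset[of ?K J] card_mono[of J ?K] by simp
    ultimately show ?thesis using x by simp
  qed
  have "x ^ Suc j \<le> real (card (disjoint_lists J j)) * x"
    using Suc x mult_right_mono[of "x ^ j" "real (card (disjoint_lists J j))" x]
    by (simp add: mult.commute)
  also have "\<dots> \<le> (\<Sum>l\<in>disjoint_lists J j. \<Sum>e | e \<in> J \<and> (\<forall>f\<in>set l. e \<inter> f = {}). 1)"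
    using sum_mono[of "disjoint_lists J j" "\<lambda>_. x", OF ext] by simp
  also have "\<dots> = (\<Sum>l\<in>disjoint_lists J (Suc j). 1)"
    by (rule sum_disjoint_lists_Suc[OF fin, symmetric])
  finally show ?case by simp
qed auto

text \<open>If many edges are present and each of them meets few others, then there are many ordered
  lists of \<open>s\<close> pairwise disjoint edges; by independence the expected number of
  such lists is at most \<open>\<mu> ^ s\<close>.\<close>

lemma bprob_bounded_degree_upper_tail:
  fixes p t C :: real
  assumes V: "finite V" "H \<subseteq> Pow V" and p: "0 \<le> p" "p \<le> 1" and t: "0 < t"
    and C: "0 \<le> C" "real s * C \<le> t / 2" and \<mu>: "\<mu> = (\<Sum>e\<in>H. p ^ card e)"
  shows "bprob V p (\<lambda>A. \<exists>J\<subseteq>{e \<in> H. e \<subseteq> A}. real (card J) \<ge> \<mu> + t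
      \<and> (\<forall>e\<in>J. real (card {f \<in> J. f \<inter> e \<noteq> {}}) \<le> C)) \<le> (\<mu> / (\<mu> + t / 2)) ^ s"
proof -
  have \<mu>0: "0 \<le> \<mu>" unfolding \<mu> using p by (intro sum_nonneg) auto
  have finH: "finite H" using V finite_subset[of H "Pow V"] by auto
  have "bprob V p (\<lambda>A. \<exists>J\<subseteq>{e \<in> H. e \<subseteq> A}. real (card J) \<ge> \<mu> + t
      \<and> (\<forall>e\<in>J. real (card {f \<in> J. f \<inter> e \<noteq> {}}) \<le> C)) \<le> (\<Sum>e\<in>H. p ^ card e) ^ s / (\<mu> + t / 2) ^ s"
  proof (rule bprob_disjoint_lists[OF V p])
    fix A assume "\<exists>J\<subseteq>{e \<in> H. e \<subseteq> A}. real (card J) \<ge> \<mu> + t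
      \<and> (\<forall>e\<in>J. real (card {f \<in> J. f \<inter> e \<noteq> {}}) \<le> C)"
    then obtain J where J: "J \<subseteq> {e \<in> H. e \<subseteq> A}" "real (card J) \<ge> \<mu> + t"
      "\<And>e. e \<in> J \<Longrightarrow> real (card {f \<in> J. f \<inter> e \<noteq> {}}) \<le> C" by auto
    have "(\<mu> + t / 2) ^ s \<le> real (card (disjoint_lists J s))"
      using J C \<mu>0 t finH finite_subset[of J H] by (intro card_disjoint_lists_ge) auto
    also have "\<dots> \<le> real (card (disjoint_lists {e \<in> H. e \<subseteq> A} s))"
      using J finH by (intro of_nat_mono card_mono disjoint_lists_mono finite_disjoint_lists) auto
    finally show "(\<mu> + t / 2) ^ s \<le> real (card (disjoint_lists {e \<in> H. e \<subseteq> A} s))" .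
  qed (use t \<mu>0 in auto)
  then show ?thesis by (simp add: power_divide \<mu>)
qed

text \<open>A star is a sunflower with a one-point core. The image of \<open>stars\<close> under
  \<open>Union\<close> treats each star as one large edge, so \<open>disjoint_lists\<close> over
  that image enumerates vertex-disjoint stars.\<close>

definition stars :: "'a set set \<Rightarrow> nat \<Rightarrow> 'a set set set" where
  "stars H s = {F. F \<subseteq> H \<and> card F = s \<and>
     (\<exists>v. (\<forall>e\<in>F. v \<in> e) \<and> (\<forall>e\<in>F. \<forall>f\<in>F. e \<noteq> f \<longrightarrow> e \<inter> f = {v}))}"

text \<open>The petals without the centre are disjoint and have \<open>k - 1\<close> points each.
  The lower bound enters the probability of a star, the upper bound the cost of deleting all edges
  that touch it.\<close>

lemma card_Union_star:
  assumes "F \<in> stars H s" "\<And>e. e \<in> H \<Longrightarrow> finite e \<and> card e = k" "finite H"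
  shows "finite (\<Union>F)" "(k - 1) * s \<le> card (\<Union>F)" "card (\<Union>F) \<le> k * s"
proof -
  have F12: "F \<subseteq> H" "card F = s" using assms(1) by (auto simp: stars_def)
  obtain v where F34: "\<forall>e\<in>F. v \<in> e" "\<forall>e\<in>F. \<forall>f\<in>F. e \<noteq> f \<longrightarrow> e \<inter> f = {v}"
    using assms(1) unfolding stars_def mem_Collect_eq by (elim conjE exE)
  note F = F12 F34
  have finF: "finite F" using F(1) assms(3) finite_subset by auto
  show fin: "finite (\<Union>F)" using F(1) assms(2) finF by (meson finite_Union subsetD)
  have "card (\<Union>e\<in>F. e - {v}) = (\<Sum>e\<in>F. card (e - {v}))"
  proof (rule card_UN_disjoint[OF finF])
    show "\<forall>e\<in>F. finite (e - {v})" using F(1) assms(2) by (meson finite_Diff subsetD)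
    show "\<forall>e\<in>F. \<forall>f\<in>F. e \<noteq> f \<longrightarrow> (e - {v}) \<inter> (f - {v}) = {}"
    proof (intro ballI impI)
      fix e f assume "e \<in> F" "f \<in> F" "e \<noteq> f"
      then have "e \<inter> f = {v}" using F(4) by simp
      then show "(e - {v}) \<inter> (f - {v}) = {}" by blast
    qed
  qed
  also have "\<dots> = (\<Sum>e\<in>F. k - 1)"
  proof (intro sum.cong refl)
    fix e assume "e \<in> F"
    then show "card (e - {v}) = k - 1" using F(1,3) assms(2)[of e] by auto
  qed
  finally have "(k - 1) * s = card (\<Union>e\<in>F. e - {v})" using F(2) by simp
  also have "\<dots> \<le> card (\<Union>F)" using fin by (intro card_mono) auto
  finally show "(k - 1) * s \<le> card (\<Union>F)" .
  have "card (\<Union>F) \<le> (\<Sum>e\<in>F. card e)" by (rule card_Union_le_sum_card)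
  also have "\<dots> = (\<Sum>e\<in>F. k)" using F(1) assms(2) by (intro sum.cong) auto
  finally show "card (\<Union>F) \<le> k * s" using F(2) by (simp add: mult.commute)
qed

lemma card_stars_le:
  assumes V: "finite V" "H \<subseteq> Pow V" and s: "1 \<le> s"
    and d: "\<And>v. v \<in> V \<Longrightarrow> card {e \<in> H. v \<in> e} \<le> d"
  shows "finite (stars H s)" "card (stars H s) \<le> card V * (d choose s)"
proof -
  have finH: "finite H" using V finite_subset[of H "Pow V"] by auto
  let ?T = "\<lambda>v. {F. F \<subseteq> {e \<in> H. v \<in> e} \<and> card F = s}"
  have finT: "finite (?T v)" for v
    by (rule finite_subset[of _ "Pow H"]) (use finH in auto)
  have sub: "stars H s \<subseteq> (\<Union>v\<in>V. ?T v)"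
  proof
    fix F assume "F \<in> stars H s"
    then obtain v where F: "F \<subseteq> H" "card F = s" "\<forall>e\<in>F. v \<in> e"
      unfolding stars_def mem_Collect_eq by (elim conjE exE)
    have "F \<noteq> {}" using s F(2) by auto
    then have "v \<in> V" using F(1,3) V(2) by auto
    then show "F \<in> (\<Union>v\<in>V. ?T v)" using F by auto
  qed
  then show "finite (stars H s)" using V finT by (meson finite_UN finite_subset)
  have "card (stars H s) \<le> card (\<Union>v\<in>V. ?T v)" using sub V finT by (intro card_mono) auto
  also have "\<dots> \<le> (\<Sum>v\<in>V. card (?T v))" by (rule card_UN_le[OF V(1)])
  also have "\<dots> \<le> (\<Sum>v\<in>V. d choose s)"
    using d finH by (intro sum_mono) (simp add: n_subsets binomial_right_mono)
  finally show "card (stars H s) \<le> card V * (d choose s)" by simp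
qed

lemma bprob_disjoint_stars:
  fixes p :: real
  assumes V: "finite V" "H \<subseteq> Pow V" "\<And>e. e \<in> H \<Longrightarrow> card e = k" and s: "1 \<le> s"
    and d: "\<And>v. v \<in> V \<Longrightarrow> card {e \<in> H. v \<in> e} \<le> d" and p: "0 \<le> p" "p \<le> 1"
  shows "bprob V p (\<lambda>A. disjoint_lists (Union ` stars {e \<in> H. e \<subseteq> A} s) r \<noteq> {})
    \<le> (real (card V) * real (d choose s) * (p ^ (k - 1)) ^ s) ^ r"
proof -
  have finH: "finite H" "\<And>e. e \<in> H \<Longrightarrow> finite e"
    using V finite_subset[of H "Pow V"] by (auto intro: finite_subset)
  let ?G = "Union ` stars H s"
  have finS: "finite (stars H s)" "card (stars H s) \<le> card V * (d choose s)"
    using card_stars_le[OF V(1,2) s d] by auto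
  have G: "?G \<subseteq> Pow V" using V by (auto simp: stars_def)
  have restr: "Union ` stars {e \<in> H. e \<subseteq> A} s = {e \<in> ?G. e \<subseteq> A}" for A
  proof -
    have "F \<subseteq> {e \<in> H. e \<subseteq> A} \<longleftrightarrow> F \<subseteq> H \<and> \<Union>F \<subseteq> A" for F by blast
    then have "stars {e \<in> H. e \<subseteq> A} s = {F \<in> stars H s. \<Union>F \<subseteq> A}"
      unfolding stars_def by simp blast
    moreover have "g ` {F \<in> S. P (g F)} = {e \<in> g ` S. P e}"
      for g :: "'a set set \<Rightarrow> 'a set" and S P
      by auto
    ultimately show ?thesis by simp
  qed
  \<comment> \<open>Different stars may have the same union, so passing from the image to the stars
    gives only an inequality.\<close>
  have "(\<Sum>e\<in>?G. p ^ card e) \<le> (\<Sum>F\<in>stars H s. p ^ card (\<Union>F))"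
    using finS p by (intro order_trans[OF sum_image_le]) auto
  also have "\<dots> \<le> (\<Sum>F\<in>stars H s. p ^ ((k - 1) * s))"
  proof (intro sum_mono power_decreasing p)
    fix F assume "F \<in> stars H s"
    then show "(k - 1) * s \<le> card (\<Union>F)"
      by (rule card_Union_star(2)) (use V(3) finH in auto)
  qed
  also have "\<dots> \<le> real (card V * (d choose s)) * p ^ ((k - 1) * s)"
    using finS p by (simp del: of_nat_mult add: mult_right_mono)
  finally have sum: "(\<Sum>e\<in>?G. p ^ card e) \<le> real (card V) * real (d choose s) * (p ^ (k - 1)) ^ s"
    by (simp add: power_mult)
  have "bprob V p (\<lambda>A. disjoint_lists (Union ` stars {e \<in> H. e \<subseteq> A} s) r \<noteq> {})
      = bprob V p (\<lambda>A. disjoint_lists {e \<in> ?G. e \<subseteq> A} r \<noteq> {})"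
    by (simp only: restr)
  also have "\<dots> \<le> (\<Sum>e\<in>?G. p ^ card e) ^ r / 1"
  proof (rule bprob_disjoint_lists[OF V(1) G p])
    fix A assume "disjoint_lists {e \<in> ?G. e \<subseteq> A} r \<noteq> {}"
    moreover have "finite (disjoint_lists {e \<in> ?G. e \<subseteq> A} r)"
      using finS by (intro finite_disjoint_lists) auto
    ultimately show "1 \<le> real (card (disjoint_lists {e \<in> ?G. e \<subseteq> A} r))"
      by (metis card_gt_0_iff One_nat_def Suc_leI of_nat_1 of_nat_mono)
  qed simp
  also have "\<dots> \<le> (real (card V) * real (d choose s) * (p ^ (k - 1)) ^ s) ^ r"
    using power_mono[OF sum, of r] p by (simp add: sum_nonneg)
  finally show ?thesis .
qed

text \<open>Greedy choice of petals: \<open>s\<close> petals cover at most \<open>k * s\<close>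
  points besides \<open>v\<close>, each in at most \<open>D\<close> edges of \<open>K\<close>, so
  some edge of \<open>K\<close> avoids them all.\<close>

lemma obtain_star:
  assumes "finite K" "\<And>e. e \<in> K \<Longrightarrow> v \<in> e" "\<And>e. e \<in> K \<Longrightarrow> finite e \<and> card e = k" "2 \<le> k"
    and D: "\<And>u. u \<noteq> v \<Longrightarrow> card {e \<in> K. u \<in> e} \<le> D" and "k * s * D < card K"
  shows "\<exists>F\<subseteq>K. card F = s \<and> (\<forall>e\<in>F. \<forall>f\<in>F. e \<noteq> f \<longrightarrow> e \<inter> f = {v})"
  using \<open>k * s * D < card K\<close>
proof (induction s)
  case 0
  then show ?case by (intro exI[of _ "{}"]) auto
next
  case (Suc s)
  have "k * s * D < card K" using Suc.prems by (simp add: algebra_simps)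
  then obtain F where F: "F \<subseteq> K" "card F = s"
    "\<And>e f. e \<in> F \<Longrightarrow> f \<in> F \<Longrightarrow> e \<noteq> f \<Longrightarrow> e \<inter> f = {v}"
    using Suc.IH by blast
  have finF: "finite F" "\<And>e. e \<in> F \<Longrightarrow> finite e"
    using F(1) assms(1,3) finite_subset by auto
  let ?W = "\<Union>F - {v}"
  have "card ?W \<le> card (\<Union>F)" using finF by (intro card_mono) auto
  also have "\<dots> \<le> (\<Sum>e\<in>F. card e)" by (rule card_Union_le_sum_card)
  also have "\<dots> = (\<Sum>e\<in>F. k)" using F(1) assms(3) by (intro sum.cong) auto
  finally have W: "card ?W \<le> k * s" using F(2) by (simp add: mult.commute)
  have "card (\<Union>u\<in>?W. {e \<in> K. u \<in> e}) \<le> (\<Sum>u\<in>?W. card {e \<in> K. u \<in> e})"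
    using finF by (intro card_UN_le) auto
  also have "\<dots> \<le> (\<Sum>u\<in>?W. D)" using D by (intro sum_mono) auto
  also have "\<dots> \<le> k * Suc s * D" using W by (simp add: mult_le_mono1 trans_le_add2)
  finally have "card (\<Union>u\<in>?W. {e \<in> K. u \<in> e}) < card K" using Suc.prems by simp
  moreover have "finite (\<Union>u\<in>?W. {e \<in> K. u \<in> e})" using assms(1) finF by auto
  ultimately have "\<not> K \<subseteq> (\<Union>u\<in>?W. {e \<in> K. u \<in> e})"
    by (meson card_mono not_le)
  then obtain e where e: "e \<in> K" "e \<inter> ?W = {}" by blast
  \<comment> \<open>As \<open>k \<ge> 2\<close>, the new edge has a point other than
    \<open>v\<close>, which would lie in \<open>?W\<close> if the edge were already in
    \<open>F\<close>.\<close>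
  have "e \<noteq> {v}" using assms(3)[OF e(1)] assms(4) by auto
  then have "e \<notin> F" using e assms(2) by blast
  moreover have "e \<inter> f = {v}" if "f \<in> F" for f using e that assms(2) F(1) by blast
  ultimately show ?case
    using F e finF by (intro exI[of _ "insert e F"]) (auto simp: Int_commute)
qed

text \<open>Take a family of disjoint stars that cannot be extended and delete every edge meeting
  it. A remaining vertex of degree above \<open>k * s * D\<close> would, by
  \<open>obtain_star\<close>, be the centre of a star avoiding the family. The family has at most
  \<open>r - 1\<close> stars of at most \<open>k * s\<close> points, and each point costs at most
  \<open>d\<close> edges.\<close>

lemma degree_reduction:
  assumes J: "finite J" "\<And>e. e \<in> J \<Longrightarrow> finite e \<and> card e = k" and k: "2 \<le> k"
    and D: "\<And>u v. u \<noteq> v \<Longrightarrow> card {e \<in> J. u \<in> e \<and> v \<in> e} \<le> D"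
    and d: "\<And>v. card {e \<in> J. v \<in> e} \<le> d"
    and none: "disjoint_lists (Union ` stars J s) r = {}"
  shows "\<exists>J'\<subseteq>J. card (J - J') \<le> (r - 1) * (k * s) * d \<and> (\<forall>v. card {e \<in> J'. v \<in> e} \<le> k * s * D)"
proof -
  let ?G = "Union ` stars J s"
  \<comment> \<open>\<open>q\<close> is the first length without a list, so a list of length
    \<open>q - 1\<close> cannot be extended; \<open>q\<close> is positive because of the empty
    list.\<close>
  define q where "q = (LEAST j. disjoint_lists ?G j = {})"
  have q: "disjoint_lists ?G q = {}"
    unfolding q_def by (rule LeastI[of "\<lambda>j. disjoint_lists ?G j = {}" r]) (rule none)
  have qr: "q \<le> r" unfolding q_def by (rule Least_le) (rule none)
  have "q \<noteq> 0" using q by (cases q) auto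
  then obtain q' where q': "q = Suc q'" using not0_implies_Suc by auto
  then have "disjoint_lists ?G q' \<noteq> {}"
    using not_less_Least[of q' "\<lambda>j. disjoint_lists ?G j = {}"] by (simp add: q_def)
  then obtain l where l: "l \<in> disjoint_lists ?G q'" by auto
  have l': "set l \<subseteq> ?G" "length l = q'" using disjoint_lists_subset[OF l] by auto
  let ?U = "\<Union>(set l)"
  have star: "finite S \<and> card S \<le> k * s" if "S \<in> set l" for S
    using that l'(1) card_Union_star[OF _ J(2,1)] by blast
  have "card ?U \<le> (\<Sum>S\<in>set l. card S)" by (rule card_Union_le_sum_card)
  also have "\<dots> \<le> (\<Sum>S\<in>set l. k * s)" using star by (intro sum_mono) auto
  also have "\<dots> \<le> (r - 1) * (k * s)"
    using card_length[of l] l' qr q' by (auto intro!: mult_le_mono1)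
  finally have U: "card ?U \<le> (r - 1) * (k * s)" .
  have finU: "finite ?U" using star by auto
  let ?J = "{e \<in> J. e \<inter> ?U = {}}"
  have "card (J - ?J) \<le> card (\<Union>u\<in>?U. {e \<in> J. u \<in> e})"
    using J(1) by (intro card_mono finite_UN_I[OF finU]) auto
  also have "\<dots> \<le> (\<Sum>u\<in>?U. card {e \<in> J. u \<in> e})" using finU by (rule card_UN_le)
  also have "\<dots> \<le> (\<Sum>u\<in>?U. d)" using d by (intro sum_mono) auto
  also have "\<dots> \<le> (r - 1) * (k * s) * d" using U by simp
  finally have 1: "card (J - ?J) \<le> (r - 1) * (k * s) * d" .
  have 2: "card {e \<in> ?J. v \<in> e} \<le> k * s * D" for v
  proof (rule ccontr)
    assume "\<not> card {e \<in> ?J. v \<in> e} \<le> k * s * D"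
    moreover have "card {e \<in> {e \<in> ?J. v \<in> e}. u \<in> e} \<le> D" if "u \<noteq> v" for u
      using J(1) by (intro order_trans[OF card_mono D[OF that]]) auto
    ultimately have "\<exists>F\<subseteq>{e \<in> ?J. v \<in> e}. card F = s \<and> (\<forall>e\<in>F. \<forall>f\<in>F. e \<noteq> f \<longrightarrow> e \<inter> f = {v})"
      using J k by (intro obtain_star) auto
    then obtain F where F: "F \<subseteq> {e \<in> ?J. v \<in> e}" "card F = s"
      "\<forall>e\<in>F. \<forall>f\<in>F. e \<noteq> f \<longrightarrow> e \<inter> f = {v}" by blast
    then have "F \<in> stars J s" unfolding stars_def by blast
    moreover have "\<forall>f\<in>set l. \<Union>F \<inter> f = {}" using F(1) by blast
    ultimately have "\<Union>F # l \<in> disjoint_lists ?G (Suc q')" using l by (auto simp: image_iff)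
    then show False using q q' by simp
  qed
  show ?thesis using 1 2 by (intro exI[of _ ?J]) auto
qed

lemma card_meeting_le:
  assumes J: "finite J" and e: "finite e" "card e \<le> k" and d: "\<And>v. card {f \<in> J. v \<in> f} \<le> d"
  shows "card {f \<in> J. f \<inter> e \<noteq> {}} \<le> k * d"
proof -
  have "card {f \<in> J. f \<inter> e \<noteq> {}} \<le> card (\<Union>v\<in>e. {f \<in> J. v \<in> f})"
    using J e by (intro card_mono) auto
  also have "\<dots> \<le> (\<Sum>v\<in>e. card {f \<in> J. v \<in> f})" using e by (intro card_UN_le) auto
  also have "\<dots> \<le> (\<Sum>v\<in>e. d)" using d by (intro sum_mono) auto
  also have "\<dots> \<le> k * d" using e by simp
  finally show ?thesis .
qed

section \<open>Variance of the number of edges\<close>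

lemma binomial_le_power_exp:
  assumes "1 \<le> s"
  shows "real (d choose s) \<le> (exp 1 * real d / real s) ^ s"
proof -
  have exp_sums: "(\<lambda>j. real s ^ j /\<^sub>R fact j) sums exp (real s)" by (rule exp_converges)
  \<comment> \<open>A single term of the series for \<open>exp s\<close> gives
    \<open>s! \<ge> (s / e) ^ s\<close>.\<close>
  have "real s ^ s /\<^sub>R fact s = (\<Sum>j\<in>{s}. real s ^ j /\<^sub>R fact j)" by simp
  also have "\<dots> \<le> (\<Sum>j. real s ^ j /\<^sub>R fact j)"
    using sums_summable[OF exp_sums] by (intro sum_le_suminf) auto
  also have "\<dots> = exp 1 ^ s" using sums_unique[OF exp_sums] by (simp flip: exp_of_nat_mult)
  finally have s: "real s ^ s \<le> exp 1 ^ s * fact s" by (simp add: field_simps)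
  have "real (d choose s) * fact s \<le> real d ^ s"
    using of_nat_mono[OF binomial_fact_pow[of d s], where 'a=real] by simp
  then have "real (d choose s) * (exp 1 ^ s * fact s) \<le> exp 1 ^ s * real d ^ s"
    by (simp add: mult.left_commute)
  moreover have "real (d choose s) * real s ^ s \<le> real (d choose s) * (exp 1 ^ s * fact s)"
    by (intro mult_left_mono s) simp
  ultimately have "real (d choose s) * real s ^ s \<le> exp 1 ^ s * real d ^ s" by linarith
  then show ?thesis using assms by (simp add: power_divide power_mult_distrib field_simps)
qed

text \<open>The centre costs a factor \<open>card V \<le> exp m\<close>, the petals at most
  \<open>(e * k * m / s) ^ s\<close>. In the requirement on \<open>s\<close>, one factor
  \<open>e\<close> of \<open>exp 2\<close> pays for the binomial bound and the other creates the
  summand 1 in \<open>1 + ln \<rho>\<close>. Since \<open>m \<le> s / 2\<close>, half of the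
  exponent pays for the centre.\<close>

lemma bprob_disjoint_stars_exp:
  fixes p m \<rho> :: real
  assumes V: "finite V" "H \<subseteq> Pow V" "\<And>e. e \<in> H \<Longrightarrow> card e = k" and k: "1 \<le> k"
    and d: "\<And>v. v \<in> V \<Longrightarrow> card {e \<in> H. v \<in> e} \<le> k * card V" and p: "0 \<le> p" "p \<le> 1"
    and m: "m = real (card V) * p ^ (k - 1)" "real (card V) \<le> exp m" "0 < m"
    and s: "1 \<le> s" "real k * exp 2 * m * \<rho> \<le> real s" and \<rho>: "1 \<le> \<rho>"
  shows "bprob V p (\<lambda>A. disjoint_lists (Union ` stars {e \<in> H. e \<subseteq> A} s) r \<noteq> {})
    \<le> exp (- (real r * real s / 2) * (1 + ln \<rho>))"
proof -
  let ?x = "exp 1 * (real k * m) / real s"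
  have "exp (2 :: real) = exp 1 * exp 1" by (simp flip: exp_add)
  then have "?x * (exp 1 * \<rho>) = real k * exp 2 * m * \<rho> / real s" by simp
  also have "\<dots> \<le> 1" using s by simp
  finally have x: "?x \<le> exp (- 1 - ln \<rho>)"
    using \<rho> by (simp add: exp_diff exp_minus field_simps)
  have "(2 :: real) \<le> exp 2" using exp_ge_add_one_self[of 2] by simp
  then have "1 * 2 * m * 1 \<le> real k * exp 2 * m * \<rho>"
    using k m \<rho> by (intro mult_mono) auto
  then have ms: "m \<le> real s / 2" using s by simp
  have "real (card V) * real (k * card V choose s) * (p ^ (k - 1)) ^ s
      \<le> exp m * (exp 1 * real (k * card V) / real s) ^ s * (p ^ (k - 1)) ^ s"
    using m p by (intro mult_right_mono mult_mono binomial_le_power_exp s) auto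
  also have "\<dots> = exp m * ?x ^ s"
    unfolding m(1) by (simp add: mult.assoc flip: power_mult_distrib)
  also have "\<dots> \<le> exp m * exp (- 1 - ln \<rho>) ^ s"
    using x m k by (intro mult_left_mono power_mono) auto
  also have "\<dots> = exp (m - real s * (1 + ln \<rho>))"
    by (simp add: algebra_simps flip: exp_of_nat_mult exp_add)
  also have "\<dots> \<le> exp (- (real s / 2) * (1 + ln \<rho>))"
  proof -
    have "0 \<le> real s * ln \<rho>" using \<rho> by simp
    then show ?thesis using ms by (simp add: field_simps)
  qed
  finally have "(real (card V) * real (k * card V choose s) * (p ^ (k - 1)) ^ s) ^ r
      \<le> exp (- (real s / 2) * (1 + ln \<rho>)) ^ r"
    using p by (intro power_mono) auto
  also have "\<dots> = exp (- (real r * real s / 2) * (1 + ln \<rho>))"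
    by (simp add: algebra_simps flip: exp_of_nat_mult)
  finally show ?thesis
    using bprob_disjoint_stars[OF V s(1) d p, of r] by linarith
qed

section \<open>Edge counts and their variance\<close>

definition edge_count :: "'a set set \<Rightarrow> 'a set \<Rightarrow> real" where
  "edge_count H A = real (card {e \<in> H. e \<subseteq> A})"

text \<open>The variance expanded into covariances of the indicators of
  \<open>e \<subseteq> A\<close>. For \<open>p\<close> in [0,1] all terms are nonnegative, so it is
  monotone in \<open>H\<close>; planting relies on this.\<close>

definition edge_var :: "'a set set \<Rightarrow> real \<Rightarrow> real" where
  "edge_var H p = (\<Sum>e\<in>H. \<Sum>f\<in>H. p ^ card (e \<union> f) - p ^ card e * p ^ card f)"

lemma edge_count_sum: "finite H \<Longrightarrow> edge_count H A = (\<Sum>e\<in>H. of_bool (e \<subseteq> A))"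
  by (simp add: edge_count_def of_bool_def sum.If_cases Int_def)

lemma bexp_edge_count:
  assumes "finite V" "H \<subseteq> Pow V"
  shows "bexp V p (edge_count H) = (\<Sum>e\<in>H. p ^ card e)"
proof -
  have "finite H" using assms finite_subset[of H "Pow V"] by auto
  then have "bexp V p (edge_count H) = bexp V p (\<lambda>A. \<Sum>e\<in>H. of_bool (e \<subseteq> A))"
    by (intro bexp_cong) (rule edge_count_sum)
  also have "\<dots> = (\<Sum>e\<in>H. p ^ card e)"
    unfolding bexp_sum using assms by (intro sum.cong bprob_supset) auto
  finally show ?thesis .
qed

lemma bexp_edge_count_var:
  assumes V: "finite V" "H \<subseteq> Pow V"
  shows "bexp V p (\<lambda>A. (edge_count H A - bexp V p (edge_count H))\<^sup>2) = edge_var H p"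
proof -
  have fin: "finite H" using V finite_subset[of H "Pow V"] by auto
  define \<mu> where "\<mu> = bexp V p (edge_count H)"
  have "bexp V p (\<lambda>A. (edge_count H A)\<^sup>2)
      = bexp V p (\<lambda>A. \<Sum>e\<in>H. \<Sum>f\<in>H. of_bool (e \<union> f \<subseteq> A))"
    unfolding edge_count_sum[OF fin] power2_eq_square sum_product
    by (intro bexp_cong sum.cong refl) (simp flip: of_bool_conj)
  also have "\<dots> = (\<Sum>e\<in>H. \<Sum>f\<in>H. p ^ card (e \<union> f))"
    unfolding bexp_sum using V by (intro sum.cong bprob_supset) auto
  finally have sq: "bexp V p (\<lambda>A. (edge_count H A)\<^sup>2) = (\<Sum>e\<in>H. \<Sum>f\<in>H. p ^ card (e \<union> f))" .
  have "bexp V p (\<lambda>A. (edge_count H A - \<mu>)\<^sup>2)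
      = bexp V p (\<lambda>A. (edge_count H A)\<^sup>2 - ((2 * \<mu>) * edge_count H A - \<mu>\<^sup>2))"
    by (intro bexp_cong) (simp add: power2_diff)
  also have "\<dots> = bexp V p (\<lambda>A. (edge_count H A)\<^sup>2) - \<mu> * \<mu>"
    unfolding bexp_diff bexp_cmult using V
    by (simp add: bexp_const \<mu>_def[symmetric] power2_eq_square)
  also have "\<mu> * \<mu> = (\<Sum>e\<in>H. \<Sum>f\<in>H. p ^ card e * p ^ card f)"
    unfolding \<mu>_def bexp_edge_count[OF V] by (rule sum_product)
  finally show ?thesis
    unfolding sq \<mu>_def edge_var_def by (simp add: sum_subtractf)
qed

lemma edge_cov_nonneg:
  fixes p :: real
  assumes "0 \<le> p" "p \<le> 1"
  shows "0 \<le> p ^ card (e \<union> f) - p ^ card e * p ^ card f"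
  using assms power_decreasing[OF card_Un_le[of e f], of p] by (simp add: power_add)

lemma edge_var_mono:
  assumes "finite H" "H' \<subseteq> H" "0 \<le> p" "p \<le> 1"
  shows "edge_var H' p \<le> edge_var H p"
proof -
  have "edge_var H' p \<le> (\<Sum>e\<in>H'. \<Sum>f\<in>H. p ^ card (e \<union> f) - p ^ card e * p ^ card f)"
    unfolding edge_var_def using assms by (intro sum_mono sum_mono2 edge_cov_nonneg) auto
  also have "\<dots> \<le> edge_var H p"
    unfolding edge_var_def using assms by (intro sum_mono2 sum_nonneg edge_cov_nonneg) auto
  finally show ?thesis .
qed

text \<open>For fixed \<open>e\<close>, disjoint edges contribute nothing. At most
  \<open>k * d\<close> edges meet \<open>e\<close> at all, and those with one common point have a
  union of \<open>2 * k - 1\<close> points. At most \<open>k * k * D\<close> edges share a pair of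
  points with \<open>e\<close>; for these the trivial bound \<open>p ^ k\<close> is enough.\<close>

lemma edge_var_upper:
  fixes p :: real
  assumes H: "finite H" "\<And>e. e \<in> H \<Longrightarrow> finite e \<and> card e = k" and p: "0 \<le> p" "p \<le> 1"
    and d: "\<And>v. card {f \<in> H. v \<in> f} \<le> d"
    and D: "\<And>u v. u \<noteq> v \<Longrightarrow> card {f \<in> H. u \<in> f \<and> v \<in> f} \<le> D"
  shows "edge_var H p \<le> real (card H) * (real (k * d) * p ^ (2 * k - 1) + real (k * k * D) * p ^ k)"
proof -
  have "(\<Sum>f\<in>H. p ^ card (e \<union> f) - p ^ card e * p ^ card f)
      \<le> real (k * d) * p ^ (2 * k - 1) + real (k * k * D) * p ^ k" if e: "e \<in> H" for e
  proof -
    let ?K1 = "{f \<in> H. f \<inter> e \<noteq> {}}"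
    let ?P = "SIGMA u:e. e - {u}"
    let ?K2 = "\<Union>(u, v)\<in>?P. {f \<in> H. u \<in> f \<and> v \<in> f}"
    have fe: "finite e" "card e = k" using H e by auto
    then have finP: "finite ?P" by auto
    have cardP: "card ?P \<le> k * k"
      using fe card_mono[of "e \<times> e" ?P] by (auto simp: card_cartesian_product)
    have "card ?K2 \<le> (\<Sum>(u, v)\<in>?P. card {f \<in> H. u \<in> f \<and> v \<in> f})"
      using card_UN_le[OF finP, of "\<lambda>(u, v). {f \<in> H. u \<in> f \<and> v \<in> f}"] by (simp add: case_prod_unfold)
    also have "\<dots> \<le> (\<Sum>(u, v)\<in>?P. D)" by (intro sum_mono) (auto intro!: D)
    also have "\<dots> \<le> k * k * D" using cardP by (simp add: case_prod_unfold)
    finally have K2: "card ?K2 \<le> k * k * D" .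
    have K1: "card ?K1 \<le> k * d" using fe d H by (intro card_meeting_le) auto
    have fin2: "finite ?K2" using H finP by auto
    have "p ^ card (e \<union> f) - p ^ card e * p ^ card f
        \<le> of_bool (f \<in> ?K1) * p ^ (2 * k - 1) + of_bool (f \<in> ?K2) * p ^ k" if f: "f \<in> H" for f
    proof -
      have ff: "finite f" "card f = k" using H f by auto
      have un: "card (e \<union> f) + card (e \<inter> f) = 2 * k"
        using card_Un_Int[of e f] ff fe by simp
      have pp: "0 \<le> p ^ card e * p ^ card f" using p by simp
      consider "e \<inter> f = {}" | u where "e \<inter> f = {u}" | u v where "u \<in> e \<inter> f" "v \<in> e \<inter> f" "u \<noteq> v"
        by blast
      then show ?thesis
      proof cases
        case 1
        then have "card (e \<union> f) = card e + card f" using un fe ff by simp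
        then show ?thesis using p by (simp add: power_add)
      next
        case 2
        then have "card (e \<union> f) = 2 * k - 1" using un by simp
        moreover have "f \<in> ?K1" using 2 f by blast
        moreover have "0 \<le> of_bool (f \<in> ?K2) * p ^ k" using p by simp
        ultimately show ?thesis using pp by simp
      next
        case 3
        have "p ^ card (e \<union> f) \<le> p ^ k"
          using p fe ff card_mono[of "e \<union> f" e] by (intro power_decreasing) auto
        moreover have "f \<in> ?K2" using 3 f by auto
        moreover have "0 \<le> of_bool (f \<in> ?K1) * p ^ (2 * k - 1)" using p by simp
        ultimately show ?thesis using pp by simp
      qed
    qed
    then have "(\<Sum>f\<in>H. p ^ card (e \<union> f) - p ^ card e * p ^ card f)
        \<le> (\<Sum>f\<in>H. of_bool (f \<in> ?K1) * p ^ (2 * k - 1) + of_bool (f \<in> ?K2) * p ^ k)"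
      by (rule sum_mono)
    also have "\<dots> = (\<Sum>f\<in>H. of_bool (f \<in> ?K1)) * p ^ (2 * k - 1) + (\<Sum>f\<in>H. of_bool (f \<in> ?K2)) * p ^ k"
      by (simp only: sum.distrib sum_distrib_right)
    also have "(\<Sum>f\<in>H. of_bool (f \<in> ?K1)) = real (card ?K1)"
      using H by (simp add: of_bool_def sum.If_cases Int_def)
    also have "(\<Sum>f\<in>H. of_bool (f \<in> ?K2)) = real (card (H \<inter> ?K2))"
      using H by (subst of_bool_def) (simp only: sum.If_cases Collect_mem_eq, simp)
    also have "H \<inter> ?K2 = ?K2" by auto
    also have "real (card ?K1) * p ^ (2 * k - 1) + real (card ?K2) * p ^ k
        \<le> real (k * d) * p ^ (2 * k - 1) + real (k * k * D) * p ^ k"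
      using K1 K2 p by (intro add_mono mult_right_mono of_nat_mono) auto
    finally show ?thesis .
  qed
  then show ?thesis
    unfolding edge_var_def by (rule sum_bounded_above)
qed

text \<open>A pair with \<open>j\<close> common points has covariance at least \<open>j / k\<close>
  times \<open>(1 - p) * p ^ (2 * k - 1)\<close>. Summed over all pairs, \<open>j\<close> gives the
  sum of the squared degrees, which by Cauchy--Schwarz is at least
  \<open>(k * card H)^2 / card V\<close>.\<close>

lemma edge_var_lower:
  fixes p :: real
  assumes V: "finite V" "H \<subseteq> Pow V" "\<And>e. e \<in> H \<Longrightarrow> card e = k" and p: "0 \<le> p" "p \<le> 1"
    and k: "1 \<le> k"
  shows "(1 - p) * p ^ (2 * k - 1) * (real k * (real (card H))\<^sup>2) \<le> real (card V) * edge_var H p"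
proof -
  have H: "finite H" "\<And>e. e \<in> H \<Longrightarrow> finite e"
    using V finite_subset[of H "Pow V"] by (auto intro: finite_subset)
  define deg where "deg v = (\<Sum>e\<in>H. of_bool (v \<in> e) :: real)" for v
  have inter: "real (card (e \<inter> f)) = (\<Sum>v\<in>V. of_bool (v \<in> e) * of_bool (v \<in> f))"
    if "e \<in> H" for e f
  proof -
    have "V \<inter> {v. v \<in> e \<and> v \<in> f} = e \<inter> f" using that V by auto
    then show ?thesis
      using V by (simp flip: of_bool_conj)
  qed
  have "real k * real (card H) = (\<Sum>e\<in>H. real (card (e \<inter> e)))" using V by simp
  also have "\<dots> = (\<Sum>e\<in>H. \<Sum>v\<in>V. of_bool (v \<in> e) * of_bool (v \<in> e))"
    by (intro sum.cong refl inter)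
  also have "\<dots> = (\<Sum>v\<in>V. deg v)"
    unfolding deg_def by (subst sum.swap) (simp flip: of_bool_conj)
  finally have kH: "real k * real (card H) = (\<Sum>v\<in>V. deg v)" .
  have "(\<Sum>v\<in>V. 1 * deg v)\<^sup>2 \<le> (\<Sum>v\<in>V. 1\<^sup>2) * (\<Sum>v\<in>V. (deg v)\<^sup>2)"
    by (rule Cauchy_Schwarz_ineq_sum)
  then have "(real k * real (card H))\<^sup>2 \<le> real (card V) * (\<Sum>v\<in>V. (deg v)\<^sup>2)"
    unfolding kH by simp
  also have "(\<Sum>v\<in>V. (deg v)\<^sup>2)
      = (\<Sum>v\<in>V. \<Sum>e\<in>H. \<Sum>f\<in>H. of_bool (v \<in> e) * of_bool (v \<in> f))"
    unfolding deg_def power2_eq_square sum_product ..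
  also have "\<dots> = (\<Sum>e\<in>H. \<Sum>f\<in>H. \<Sum>v\<in>V. of_bool (v \<in> e) * of_bool (v \<in> f))"
    by (subst sum.swap, intro sum.cong refl sum.swap)
  also have "\<dots> = (\<Sum>e\<in>H. \<Sum>f\<in>H. real (card (e \<inter> f)))"
    using inter by (intro sum.cong) auto
  finally have 1: "(real k * real (card H))\<^sup>2 \<le> real (card V) * (\<Sum>e\<in>H. \<Sum>f\<in>H. real (card (e \<inter> f)))" .
  have "(1 - p) * p ^ (2 * k - 1) * real (card (e \<inter> f))
      \<le> real k * (p ^ card (e \<union> f) - p ^ card e * p ^ card f)" if e: "e \<in> H" and f: "f \<in> H" for e f
  proof -
    define j where "j = card (e \<inter> f)"
    have un: "card (e \<union> f) + j = 2 * k"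
      using card_Un_Int[of e f] V(3) H e f by (simp add: j_def)
    have jk: "j \<le> k" using card_mono[of e "e \<inter> f"] V(3) H e by (simp add: j_def)
    have "p ^ card e * p ^ card f = p ^ card (e \<union> f) * p ^ j"
      using un V(3) e f by (simp flip: power_add mult_2)
    then have eq: "p ^ card (e \<union> f) - p ^ card e * p ^ card f = p ^ card (e \<union> f) * (1 - p ^ j)"
      by (simp add: algebra_simps)
    show ?thesis
    proof (cases "j = 0")
      case True
      then show ?thesis using eq by (simp add: j_def[symmetric])
    next
      case False
      then have "p ^ j \<le> p ^ 1" using p by (intro power_decreasing) auto
      moreover have "p ^ (2 * k - 1) \<le> p ^ card (e \<union> f)"
        using p un False by (intro power_decreasing) auto
      ultimately have base: "p ^ (2 * k - 1) * (1 - p) \<le> p ^ card (e \<union> f) * (1 - p ^ j)"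
        using p by (intro mult_mono) auto
      then have "real j * (p ^ (2 * k - 1) * (1 - p)) \<le> real k * (p ^ card (e \<union> f) * (1 - p ^ j))"
        by (intro mult_mono[OF _ base]) (use jk p in auto)
      then show ?thesis unfolding eq j_def[symmetric] by (simp add: mult_ac)
    qed
  qed
  then have "(\<Sum>e\<in>H. \<Sum>f\<in>H. (1 - p) * p ^ (2 * k - 1) * real (card (e \<inter> f)))
      \<le> (\<Sum>e\<in>H. \<Sum>f\<in>H. real k * (p ^ card (e \<union> f) - p ^ card e * p ^ card f))"
    by (intro sum_mono)
  then have 2: "(1 - p) * p ^ (2 * k - 1) * (\<Sum>e\<in>H. \<Sum>f\<in>H. real (card (e \<inter> f)))
      \<le> real k * edge_var H p"
    unfolding edge_var_def by (simp only: sum_distrib_left)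
  have "(1 - p) * p ^ (2 * k - 1) * (real k * real (card H))\<^sup>2
      \<le> (1 - p) * p ^ (2 * k - 1) * (real (card V) * (\<Sum>e\<in>H. \<Sum>f\<in>H. real (card (e \<inter> f))))"
    using p by (intro mult_left_mono 1) auto
  also have "\<dots> \<le> real (card V) * (real k * edge_var H p)"
    using mult_left_mono[OF 2, of "real (card V)"] by (simp add: mult_ac)
  finally have "real k * ((1 - p) * p ^ (2 * k - 1) * (real k * (real (card H))\<^sup>2))
      \<le> real k * (real (card V) * edge_var H p)"
    by (simp add: power2_eq_square mult_ac)
  then show ?thesis using k by simp
qed

section \<open>Counting arithmetic progressions\<close>

lemma finite_arith_progs [simp]: "finite A \<Longrightarrow> finite (arith_progs k A)"
  by (rule finite_subset[of _ "Pow A"]) (auto simp: arith_progs_def)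

lemma arith_progs_Pow: "arith_progs k A \<subseteq> Pow A"
  by (auto simp: arith_progs_def)

lemma arith_progs_card: "S \<in> arith_progs k A \<Longrightarrow> card S = k"
  by (auto simp: arith_progs_def)

lemma arith_progs_restrict: "A \<subseteq> B \<Longrightarrow> {S \<in> arith_progs k B. S \<subseteq> A} = arith_progs k A"
  by (auto simp: arith_progs_def)

lemma num_AP_edge_count: "A \<subseteq> {1..n} \<Longrightarrow> num_AP k A = edge_count (arith_progs k {1..n}) A"
  by (simp add: num_AP_def edge_count_def arith_progs_restrict)

lemma arith_progs_obtain:
  assumes "S \<in> arith_progs k {1..n}" "2 \<le> k"
  obtains a d where "S = (\<lambda>i. a + i * d) ` {..<k}" "a \<in> {1..n}" "d < n"
proof -
  obtain a d where S: "S = (\<lambda>i. a + i * d) ` {..<k}" and sub: "S \<subseteq> {1..n}"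
    using assms by (auto simp: arith_progs_def)
  have "a + 0 * d \<in> S" "a + 1 * d \<in> S" unfolding S using assms(2) by (auto intro!: image_eqI)
  then have "a \<in> {1..n}" "a + d \<in> {1..n}" using sub by auto
  then show ?thesis using that[OF S] by auto
qed

lemma card_arith_progs_le:
  assumes "2 \<le> k"
  shows "card (arith_progs k {1..n}) \<le> n * n"
proof -
  let ?f = "\<lambda>(a, d). (\<lambda>i. a + i * d) ` {..<k}"
  have "arith_progs k {1..n} \<subseteq> ?f ` ({1..n} \<times> {..<n})"
  proof
    fix S assume S: "S \<in> arith_progs k {1..n}"
    obtain a d where "S = (\<lambda>i. a + i * d) ` {..<k}" "a \<in> {1..n}" "d < n"
      by (rule arith_progs_obtain[OF S assms])
    then show "S \<in> ?f ` ({1..n} \<times> {..<n})" by (intro image_eqI[of _ _ "(a, d)"]) auto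
  qed
  then have "card (arith_progs k {1..n}) \<le> card ({1..n} \<times> {..<n})"
    by (rule surj_card_le[rotated]) simp
  then show ?thesis by (simp add: card_cartesian_product)
qed

lemma arith_progs_degree:
  assumes "2 \<le> k"
  shows "card {S \<in> arith_progs k {1..n}. v \<in> S} \<le> k * n"
proof -
  \<comment> \<open>The index \<open>i\<close> of \<open>v\<close> and the difference
    \<open>d\<close> determine the progression; there \<open>v = a + i * d\<close>, so the
    subtraction is not truncated.\<close>
  let ?f = "\<lambda>(i, d). (\<lambda>j. (v - i * d) + j * d) ` {..<k}"
  have "{S \<in> arith_progs k {1..n}. v \<in> S} \<subseteq> ?f ` ({..<k} \<times> {..<n})"
  proof
    fix S assume S: "S \<in> {S \<in> arith_progs k {1..n}. v \<in> S}"
    then have "S \<in> arith_progs k {1..n}" by simp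
    then obtain a d where ad: "S = (\<lambda>i. a + i * d) ` {..<k}" "a \<in> {1..n}" "d < n"
      by (rule arith_progs_obtain[OF _ assms])
    obtain i where "i < k" "v = a + i * d" using S ad(1) by auto
    then show "S \<in> ?f ` ({..<k} \<times> {..<n})" using ad by (intro image_eqI[of _ _ "(i, d)"]) auto
  qed
  then have "card {S \<in> arith_progs k {1..n}. v \<in> S} \<le> card ({..<k} \<times> {..<n})"
    by (rule surj_card_le[rotated]) simp
  then show ?thesis by (simp add: card_cartesian_product)
qed

lemma arith_prog_eq_if_two_terms_eq:
  fixes a b d e i j :: nat
  assumes "a + i * d = b + i * e" "a + j * d = b + j * e" "i \<noteq> j"
  shows "a = b \<and> d = e"
proof -
  have "(int i - int j) * int d = (int i - int j) * int e"
    using assms(1,2) by (simp add: algebra_simps flip: of_nat_mult of_nat_add)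
  then have "d = e" using assms(3) by simp
  then show ?thesis using assms(1) by simp
qed

text \<open>The positions of \<open>u\<close> and \<open>v\<close> within the progression determine
  it, and there are at most \<open>k * k\<close> pairs of positions.\<close>

lemma arith_progs_codegree:
  assumes "2 \<le> k" "u \<noteq> v"
  shows "card {S \<in> arith_progs k {1..n}. u \<in> S \<and> v \<in> S} \<le> k * k"
proof -
  define T where "T = (\<lambda>(i, j). {S. \<exists>a d. S = (\<lambda>i. a + i * d) ` {..<k} \<and> u = a + i * d \<and> v = a + j * d})"
  have T: "finite (T x) \<and> card (T x) \<le> 1" for x
  proof -
    obtain i j where x: "x = (i, j)" by (cases x)
    have "S = S'" if "S \<in> T x" "S' \<in> T x" for S S'
    proof -
      from that obtain a d b e where *: "S = (\<lambda>i. a + i * d) ` {..<k}" "u = a + i * d" "v = a + j * d"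
        "S' = (\<lambda>i. b + i * e) ` {..<k}" "u = b + i * e" "v = b + j * e"
        unfolding x T_def by auto
      then have "i \<noteq> j" using assms(2) by auto
      then have "a = b \<and> d = e" using * by (intro arith_prog_eq_if_two_terms_eq) auto
      then show ?thesis using * by simp
    qed
    then obtain S where "T x \<subseteq> {S}" by blast
    then show ?thesis using card_mono[of "{S}" "T x"] finite_subset[of "T x" "{S}"] by simp
  qed
  have "{S \<in> arith_progs k {1..n}. u \<in> S \<and> v \<in> S} \<subseteq> (\<Union>x\<in>{..<k} \<times> {..<k}. T x)"
  proof
    fix S assume S: "S \<in> {S \<in> arith_progs k {1..n}. u \<in> S \<and> v \<in> S}"
    then obtain a d where ad: "S = (\<lambda>i. a + i * d) ` {..<k}"
      by (auto simp: arith_progs_def)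
    then obtain i j where "i < k" "u = a + i * d" "j < k" "v = a + j * d" using S by blast
    then show "S \<in> (\<Union>x\<in>{..<k} \<times> {..<k}. T x)"
      using ad by (intro UN_I[of "(i, j)"]) (auto simp: T_def)
  qed
  then have "card {S \<in> arith_progs k {1..n}. u \<in> S \<and> v \<in> S} \<le> card (\<Union>x\<in>{..<k} \<times> {..<k}. T x)"
    using T by (intro card_mono) auto
  also have "\<dots> \<le> (\<Sum>x\<in>{..<k} \<times> {..<k}. card (T x))" by (rule card_UN_le) simp
  also have "\<dots> \<le> (\<Sum>x\<in>{..<k} \<times> {..<k}. 1)" using T by (intro sum_mono) auto
  finally show ?thesis by (simp add: card_cartesian_product)
qed

lemma real_div_ge_half:
  fixes n m :: nat
  assumes "1 \<le> m" "m \<le> n"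
  shows "real n / (2 * real m) \<le> real (n div m)"
proof -
  have "1 \<le> n div m" using assms by (simp add: Suc_le_eq div_greater_zero_iff)
  moreover have "n = m * (n div m) + n mod m" "n mod m < m" using assms by auto
  then have "n \<le> m * (n div m) + m" by linarith
  ultimately have "n \<le> m * (n div m) + m * (n div m)"
    by (metis add_left_mono le_trans mult.right_neutral mult_le_mono2)
  then have "real n \<le> real (m * (n div m) + m * (n div m))" by (rule of_nat_mono)
  then show ?thesis using assms by (simp add: field_simps)
qed

lemma card_arith_progs_ge:
  assumes k: "2 \<le> k" and n: "2 * k \<le> n"
  shows "(real n)\<^sup>2 / (16 * real k) \<le> real (card (arith_progs k {1..n}))"
proof -
  let ?f = "\<lambda>(a, d). (\<lambda>i. a + i * d) ` {..<k}"
  \<comment> \<open>These ranges keep every term within \<open>n\<close>. Rounding down loses at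
    most a factor 2 in each, which leads to \<open>4 * (4 * k) = 16 * k\<close>.\<close>
  let ?A = "{1..n div 2} \<times> {1..n div (2 * k)}"
  have mem: "a \<in> ?f (a, d)" "a + d \<in> ?f (a, d)" for a d :: nat
    using k by (auto intro: image_eqI[of _ _ 0] image_eqI[of _ _ 1])
  have le: "a' \<le> a" if "a \<in> ?f (a', d')" for a a' d' :: nat using that by auto
  have "inj_on ?f ?A"
  proof (rule inj_onI)
    fix x y assume xy: "x \<in> ?A" "y \<in> ?A" "?f x = ?f y"
    obtain a d b e where x: "x = (a, d)" and y: "y = (b, e)" by (cases x, cases y)
    have d: "1 \<le> d" "1 \<le> e" using xy by (auto simp: x y)
    have eq: "?f (a, d) = ?f (b, e)" using xy by (simp add: x y)
    have "a \<in> ?f (b, e)" "b \<in> ?f (a, d)"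
      using mem(1)[of a d] mem(1)[of b e] unfolding eq .
    then have ab: "a = b" by (intro antisym le)
    \<comment> \<open>The second term of one progression is a term of the other, so
      \<open>d'\<close> is a positive multiple of \<open>e'\<close>; exchanging the roles gives
      equality.\<close>
    have "e' \<le> d'" if "?f (a, d') = ?f (a, e')" "1 \<le> d'" for d' e' :: nat
    proof -
      have "a + d' \<in> ?f (a, e')" using mem(2)[of a d'] unfolding that(1) .
      then have "\<exists>j. d' = j * e'" by auto
      then obtain j where "d' = j * e'" ..
      then show ?thesis using that(2) by (cases j) auto
    qed
    from this[of d e] this[of e d] have "d = e" using eq d ab by simp
    then show "x = y" using ab x y by simp
  qed
  then have "card ?A = card (?f ` ?A)" by (simp add: card_image)
  also have "\<dots> \<le> card (arith_progs k {1..n})"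
  proof (rule card_mono)
    show "?f ` ?A \<subseteq> arith_progs k {1..n}"
    proof
      fix S assume "S \<in> ?f ` ?A"
      then obtain a d where S: "S = (\<lambda>i. a + i * d) ` {..<k}"
        and ad: "1 \<le> a" "a \<le> n div 2" "1 \<le> d" "d \<le> n div (2 * k)" by auto
      have "2 * (k * d) \<le> n"
        using ad(4) by (metis div_times_less_eq_dividend le_trans mult.assoc mult.commute mult_le_mono2)
      moreover have "2 * a \<le> n" using ad(2) by simp
      ultimately have "a + i * d \<le> n" if "i < k" for i
        using mult_le_mono1[of i k d] that by linarith
      then have "S \<subseteq> {1..n}" using ad(1) unfolding S by auto
      moreover have "card S = k"
        unfolding S using ad by (subst card_image) (auto simp: inj_on_def)
      ultimately show "S \<in> arith_progs k {1..n}" using S by (auto simp: arith_progs_def)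
    qed
  qed simp
  finally have "real (card ?A) \<le> real (card (arith_progs k {1..n}))" by (rule of_nat_mono)
  moreover have "(real n / (2 * real 2)) * (real n / (2 * real (2 * k))) \<le> real (n div 2) * real (n div (2 * k))"
    using k n by (intro mult_mono real_div_ge_half) auto
  ultimately show ?thesis
    by (simp add: card_cartesian_product power2_eq_square field_simps)
qed

section \<open>Lower bounds for the upper tail\<close>

text \<open>The bound \<open>p \<le> 1 - \<gamma>\<close> stays outside, because tilting
  instantiates the locale a second time at a larger parameter \<open>q\<close> that need not satisfy
  it. The last assumption is the threshold condition raised to the power
  \<open>k - 1\<close>.\<close>

locale random_APs =
  fixes k n :: nat and p :: real
  assumes k3: "3 \<le> k" and nk: "2 * k \<le> n" and p0: "0 < p" and p1: "p < 1"
    and ln_n: "ln (real n) \<le> real n * p ^ (k - 1)"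
begin

abbreviation "H \<equiv> arith_progs k {1..n}"

definition "m = real n * p ^ (k - 1)"

definition "Y = (real n)\<^sup>2 * p ^ k"

definition "\<mu> = real (card H) * p ^ k"

abbreviation "V2 \<equiv> edge_var H p"

definition "L = ln (1 / p)"

lemma H_simps: "finite H" "H \<subseteq> Pow {1..n}" "e \<in> H \<Longrightarrow> finite e" "e \<in> H \<Longrightarrow> card e = k"
  using k3 by (auto simp: arith_progs_Pow arith_progs_card intro: card_ge_0_finite)

lemma m_ge_1: "1 \<le> m"
proof -
  have "exp (1 :: real) \<le> 3" by (rule exp_le)
  also have "\<dots> \<le> real n" using k3 nk by simp
  finally have "1 \<le> ln (real n)" using k3 nk by (subst ln_ge_iff) auto
  then show ?thesis using ln_n by (simp add: m_def)
qed

lemma n_le_exp_m: "real n \<le> exp m"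
proof -
  have "exp (ln (real n)) \<le> exp m" using ln_n by (simp only: exp_le_cancel_iff m_def)
  then show ?thesis using k3 nk by simp
qed

lemma m_le_np: "m \<le> real n * p"
proof -
  have "p ^ (k - 1) \<le> p ^ 1" using k3 p0 p1 by (intro power_decreasing) auto
  then show ?thesis by (simp add: m_def mult_left_mono)
qed

lemma Y_pos: "0 < Y"
  using p0 k3 nk by (simp add: Y_def)

lemma \<mu>_le_Y: "\<mu> \<le> Y"
proof -
  have "real (card H) \<le> real (n * n)" using k3 by (intro of_nat_mono card_arith_progs_le) simp
  then show ?thesis using p0 by (simp add: \<mu>_def Y_def power2_eq_square mult_right_mono)
qed

lemma Y_le_\<mu>: "Y \<le> 16 * real k * \<mu>"
proof -
  have "(real n)\<^sup>2 / (16 * real k) \<le> real (card H)"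
    using k3 nk by (intro card_arith_progs_ge) auto
  then have "(real n)\<^sup>2 \<le> 16 * real k * real (card H)" using k3 by (simp add: field_simps)
  then have "(real n)\<^sup>2 * p ^ k \<le> 16 * real k * real (card H) * p ^ k"
    using p0 by (intro mult_right_mono) auto
  then show ?thesis by (simp add: \<mu>_def Y_def mult_ac)
qed

lemma \<mu>_pos: "0 < \<mu>"
proof -
  have "0 < 16 * real k * \<mu>" using Y_le_\<mu> Y_pos by linarith
  then show ?thesis using k3 by (simp add: zero_less_mult_iff)
qed

lemma mY: "m * Y = real n ^ 3 * p ^ (2 * k - 1)"
proof -
  have "2 * k - 1 = (k - 1) + k" using k3 by simp
  then show ?thesis by (simp add: m_def Y_def power_add power2_eq_square power3_eq_cube)
qed

lemma Y_sq: "Y\<^sup>2 = m * Y * (real n * p)"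
proof -
  have "p ^ k = p ^ (k - 1) * p" using k3 by (cases k) auto
  then show ?thesis by (simp add: m_def Y_def power2_eq_square)
qed

lemma mY_ge_1: "1 \<le> m * Y"
proof -
  have "m * Y = m * m * (real n * p)"
  proof -
    have "p ^ k = p ^ (k - 1) * p" using k3 by (cases k) auto
    then show ?thesis by (simp add: m_def Y_def power2_eq_square)
  qed
  moreover have "1 * 1 * 1 \<le> m * m * (real n * p)"
    using m_ge_1 m_le_np by (intro mult_mono) auto
  ultimately show ?thesis by linarith
qed

text \<open>Since \<open>m \<ge> 1\<close>, the term \<open>Y\<close> from pairs sharing two points
  is absorbed by \<open>m * Y\<close>, the term from pairs sharing one.\<close>

lemma V2_upper: "V2 \<le> 2 * real k ^ 4 * (m * Y)"
proof -
  have deg: "card {f \<in> H. v \<in> f} \<le> k * n" for v using k3 by (intro arith_progs_degree) simp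
  have codeg: "card {f \<in> H. u \<in> f \<and> v \<in> f} \<le> k * k" if "u \<noteq> v" for u v
    using k3 that by (intro arith_progs_codegree) auto
  have "V2 \<le> real (card H) * (real (k * (k * n)) * p ^ (2 * k - 1) + real (k * k * (k * k)) * p ^ k)"
    using H_simps p0 p1 deg codeg by (intro edge_var_upper) auto
  also have "\<dots> \<le> real (n * n) * (real (k * (k * n)) * p ^ (2 * k - 1) + real (k * k * (k * k)) * p ^ k)"
    using k3 p0 by (intro mult_right_mono of_nat_mono card_arith_progs_le) auto
  also have "\<dots> = real k ^ 2 * (m * Y) + real k ^ 4 * Y"
    unfolding mY by (simp add: Y_def power2_eq_square power3_eq_cube power4_eq_xxxx algebra_simps)
  also have "\<dots> \<le> real k ^ 4 * (m * Y) + real k ^ 4 * (m * Y)"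
  proof (intro add_mono mult_right_mono mult_left_mono)
    show "real k ^ 2 \<le> real k ^ 4" using k3 by (intro power_increasing) auto
    show "Y \<le> m * Y" using m_ge_1 Y_pos by simp
  qed (use mY_ge_1 in auto)
  finally show ?thesis by linarith
qed

lemma V2_lower: "(1 - p) * (m * Y) \<le> 256 * real k * V2"
proof -
  have "(real n)\<^sup>2 / (16 * real k) \<le> real (card H)"
    using k3 nk by (intro card_arith_progs_ge) auto
  then have "((real n)\<^sup>2 / (16 * real k))\<^sup>2 \<le> (real (card H))\<^sup>2" by (intro power_mono) auto
  then have "(1 - p) * p ^ (2 * k - 1) * (real k * ((real n)\<^sup>2 / (16 * real k))\<^sup>2)
      \<le> (1 - p) * p ^ (2 * k - 1) * (real k * (real (card H))\<^sup>2)"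
    using p0 p1 by (intro mult_left_mono) auto
  also have "\<dots> \<le> real (card {1..n}) * V2"
    using H_simps p0 p1 k3 by (intro edge_var_lower) auto
  finally have "(1 - p) * p ^ (2 * k - 1) * (real k * ((real n)\<^sup>2 / (16 * real k))\<^sup>2) \<le> real n * V2"
    by simp
  moreover have "(1 - p) * p ^ (2 * k - 1) * (real k * ((real n)\<^sup>2 / (16 * real k))\<^sup>2) * (256 * real k)
      = real n * ((1 - p) * (m * Y))"
    unfolding mY using k3 by (simp add: power2_eq_square power3_eq_cube field_simps)
  ultimately have "real n * ((1 - p) * (m * Y)) \<le> real n * V2 * (256 * real k)"
    by (metis mult_right_mono of_nat_0_le_iff mult_nonneg_nonneg zero_le_numeral)
  then have "real n * ((1 - p) * (m * Y)) \<le> real n * (256 * real k * V2)" by (simp add: mult_ac)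
  then show ?thesis using k3 nk by simp
qed

lemma V2_pos: "0 < V2"
proof -
  have "0 < (1 - p) * (m * Y)" using p1 mY_ge_1 by simp
  then have "0 < 256 * real k * V2" using V2_lower by linarith
  then show ?thesis using k3 by (simp add: zero_less_mult_iff)
qed

lemma L_ge: "1 - p \<le> L"
  using ln_le_minus_one[of p] p0 by (simp add: L_def ln_div)

lemma L_pos: "0 < L"
  using L_ge p1 by simp

lemma exp_L: "p ^ j = exp (- real j * L)"
  using p0 by (simp add: L_def ln_div exp_of_nat_mult)

text \<open>Squared, this compares \<open>p ^ (2 * k - 2)\<close> with \<open>p ^ (k + 1)\<close>;
  for \<open>k = 2\<close> the factor \<open>sqrt p\<close> would not be gained.\<close>

lemma m_le: "m \<le> sqrt Y * sqrt p"
proof -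
  have "(k - 1) + (k - 1) = k + (k - 2)" using k3 by simp
  then have "p ^ (k - 1) * p ^ (k - 1) = p ^ k * p ^ (k - 2)"
    by (simp only: power_add[symmetric])
  also have "\<dots> \<le> p ^ k * p ^ 1"
    using k3 p0 p1 by (intro mult_left_mono power_decreasing) auto
  finally have "(p ^ (k - 1))\<^sup>2 \<le> p ^ k * p" by (simp add: power2_eq_square)
  then have "p ^ (k - 1) \<le> sqrt (p ^ k) * sqrt p"
    using p0 by (simp add: real_le_rsqrt flip: real_sqrt_mult)
  then have "real n * p ^ (k - 1) \<le> real n * (sqrt (p ^ k) * sqrt p)"
    by (intro mult_left_mono) auto
  then show ?thesis by (simp add: m_def Y_def real_sqrt_mult)
qed

lemma mL_le: "m * L \<le> 2 * sqrt Y"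
proof -
  have "ln (1 / sqrt p) \<le> 1 / sqrt p"
    using p0 ln_le_minus_one[of "1 / sqrt p"] by simp
  moreover have "L = 2 * ln (1 / sqrt p)" using p0 by (simp add: L_def ln_div ln_sqrt)
  ultimately have "L \<le> 2 / sqrt p" by simp
  then have Lp: "L * sqrt p \<le> 2" using p0 by (simp add: field_simps)
  have "m * L \<le> sqrt Y * sqrt p * L" using m_le L_pos by (intro mult_right_mono) auto
  also have "\<dots> = sqrt Y * (L * sqrt p)" by simp
  also have "\<dots> \<le> sqrt Y * 2" using Y_pos by (intro mult_left_mono Lp) auto
  finally show ?thesis by simp
qed

lemma bexp_H: "bexp {1..n} p (edge_count H) = \<mu>"
  using H_simps by (subst bexp_edge_count) (auto simp: \<mu>_def)

lemma bexp_H_var: "bexp {1..n} p (\<lambda>A. (edge_count H A - \<mu>)\<^sup>2) = V2"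
  unfolding bexp_H[symmetric] using H_simps by (intro bexp_edge_count_var) auto

text \<open>Forcing \<open>{1..j}\<close> lifts the contribution of the progressions inside it from
  the mean \<open>card * p ^ k\<close> to \<open>card\<close>. Of the gain \<open>2 * t\<close>, one
  \<open>t\<close> is the target and the other pays for the Cantelli loss in the count of the
  remaining progressions.\<close>

lemma bprob_plant:
  assumes j: "j \<le> n" and t: "0 < t" "V2 \<le> t\<^sup>2"
    and big: "2 * t \<le> real (card (arith_progs k {1..j})) * (1 - p ^ k)"
  shows "p ^ j / 2 \<le> bprob {1..n} p (\<lambda>A. edge_count H A \<ge> \<mu> + t)"
proof -
  let ?J = "arith_progs k {1..j}"
  let ?H' = "H - ?J"
  have JH: "?J \<subseteq> H" using j by (auto simp: arith_progs_def)
  have H': "?H' \<subseteq> Pow {1..n}" using H_simps by auto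
  have mean: "bexp {1..n} p (edge_count ?H') = \<mu> - real (card ?J) * p ^ k"
  proof -
    have "bexp {1..n} p (edge_count ?H') = (\<Sum>e\<in>?H'. p ^ k)"
      using H' H_simps by (subst bexp_edge_count) auto
    also have "\<dots> = real (card H - card ?J) * p ^ k"
      using JH H_simps by (simp add: card_Diff_subset)
    finally show ?thesis
      using card_mono[OF H_simps(1) JH] by (simp add: \<mu>_def of_nat_diff algebra_simps)
  qed
  have "bexp {1..n} p (\<lambda>A. (edge_count ?H' A - bexp {1..n} p (edge_count ?H'))\<^sup>2) \<le> t\<^sup>2"
    using edge_var_mono[of H ?H' p] H_simps p0 p1 t by (subst bexp_edge_count_var[OF _ H']) auto
  then have "1 / 2 \<le> bprob {1..n} p (\<lambda>A. edge_count ?H' A \<ge> \<mu> - real (card ?J) * p ^ k - t)"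
    (is "_ \<le> bprob _ _ ?Q")
    unfolding mean[symmetric] using p0 p1 t by (intro bprob_Cantelli_lower) auto
  then have "p ^ j * (1 / 2) \<le> p ^ card {1..j} * bprob {1..n} p ?Q"
    using p0 by (simp add: mult_left_mono)
  also have "\<dots> \<le> bprob {1..n} p (\<lambda>A. {1..j} \<subseteq> A \<and> ?Q A)"
  proof (rule bprob_supset_increasing)
    fix A B :: "nat set"
    assume AB: "A \<subseteq> B" "?Q A"
    have "edge_count ?H' A \<le> edge_count ?H' B"
      unfolding edge_count_def using AB(1) by (intro of_nat_mono card_mono) auto
    then show "?Q B" using AB(2) by linarith
  qed (use p0 p1 j in auto)
  also have "\<dots> \<le> bprob {1..n} p (\<lambda>A. edge_count H A \<ge> \<mu> + t)"
  proof (rule bprob_mono)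
    fix A assume A: "{1..j} \<subseteq> A \<and> ?Q A"
    have "{e \<in> H. e \<subseteq> A} = ?J \<union> {e \<in> ?H'. e \<subseteq> A}"
      using JH A arith_progs_Pow[of k "{1..j}"] by auto
    then have "edge_count H A = real (card ?J) + edge_count ?H' A"
      unfolding edge_count_def using H_simps(1) finite_subset[OF JH]
      by (simp only: of_nat_add[symmetric]) (subst card_Un_disjoint, auto)
    then show "edge_count H A \<ge> \<mu> + t" using A big by (simp add: algebra_simps)
  qed (use p0 p1 in auto)
  finally show ?thesis by simp
qed

text \<open>\<open>\<tau>\<close> is a lower bound for \<open>sqrt t\<close>, derived from
  \<open>V2 \<ge> \<gamma> / (256 * k)\<close>. The summands of \<open>K\<close> stand in for a
  maximum: the first makes a segment of length \<open>K * sqrt t\<close> contain enough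
  progressions, the second makes it at least \<open>2 * k\<close> long. The term
  \<open>1 / (\<gamma> * \<tau>)\<close> absorbs the factor 1/2 lost in planting.\<close>

lemma bprob_lower_clique:
  assumes \<gamma>: "0 < \<gamma>" "p \<le> 1 - \<gamma>" and t: "sqrt V2 \<le> t" and max: "\<mu> + t \<le> real (card H)"
    and \<tau>: "\<tau> = sqrt (sqrt (\<gamma> / (256 * real k)))"
    and K: "K = sqrt (32 * real k / \<gamma>) + 2 * real k / \<tau>"
  shows "exp (- (2 * K + 1 / (\<gamma> * \<tau>)) * (sqrt t * L))
    \<le> bprob {1..n} p (\<lambda>A. edge_count H A \<ge> \<mu> + t)"
proof -
  have k0: "0 < real k" using k3 by simp
  have \<tau>0: "0 < \<tau>" using \<gamma> k0 by (simp add: \<tau>)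
  have t0: "0 < t" using t V2_pos by (meson less_le_trans real_sqrt_gt_zero)
  have "\<gamma> * 1 \<le> (1 - p) * (m * Y)" using \<gamma> mY_ge_1 p1 by (intro mult_mono) auto
  then have "\<gamma> \<le> 256 * real k * V2" using V2_lower by linarith
  then have "\<gamma> / (256 * real k) \<le> V2" using k0 by (simp add: field_simps)
  then have "sqrt (\<gamma> / (256 * real k)) \<le> sqrt V2" by (rule real_sqrt_le_mono)
  then have "sqrt (\<gamma> / (256 * real k)) \<le> t" using t by linarith
  then have \<tau>t: "\<tau> \<le> sqrt t" unfolding \<tau> by (rule real_sqrt_le_mono)
  have K1: "2 * real k / \<tau> \<le> K" "sqrt (32 * real k / \<gamma>) \<le> K" and K0: "0 < K"
    using \<gamma> k0 \<tau>0 by (auto simp: K intro!: add_nonneg_pos)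
  have "2 * real k / \<tau> * \<tau> \<le> K * sqrt t"
    using K1 K0 \<tau>t \<tau>0 by (intro mult_mono) auto
  then have Kt: "2 * real k \<le> K * sqrt t" using \<tau>0 by simp
  define j where "j = nat \<lceil>K * sqrt t\<rceil>"
  have j1: "K * sqrt t \<le> real j" unfolding j_def by linarith
  have j2: "real j \<le> K * sqrt t + 1" unfolding j_def using Kt k0 by linarith
  then have j3: "real j \<le> 2 * K * sqrt t" using Kt k3 by simp
  have jL: "exp (- (2 * K + 1 / (\<gamma> * \<tau>)) * (sqrt t * L)) \<le> p ^ j / 2"
  proof -
    have "\<gamma> * \<tau> \<le> L * sqrt t"
      using L_ge \<gamma> \<tau>t \<tau>0 L_pos by (intro mult_mono) auto
    then have "1 \<le> 1 / (\<gamma> * \<tau>) * (sqrt t * L)"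
      using \<gamma> \<tau>0 by (simp add: field_simps)
    moreover have "real j * L \<le> 2 * K * sqrt t * L"
      using j3 L_pos by (intro mult_right_mono) auto
    ultimately have "- (2 * K + 1 / (\<gamma> * \<tau>)) * (sqrt t * L) \<le> - real j * L - 1"
      by (simp add: algebra_simps)
    then have "exp (- (2 * K + 1 / (\<gamma> * \<tau>)) * (sqrt t * L)) \<le> exp (- real j * L - 1)" by simp
    also have "\<dots> = p ^ j / exp 1" by (simp add: exp_L exp_diff)
    also have "\<dots> \<le> p ^ j / 2"
      using exp_ge_add_one_self[of 1] p0 by (intro divide_left_mono) auto
    finally show ?thesis .
  qed
  show ?thesis
  proof (cases "j \<le> n")
    case True
    have "(sqrt (32 * real k / \<gamma>))\<^sup>2 * (sqrt t)\<^sup>2 \<le> K\<^sup>2 * (sqrt t)\<^sup>2"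
      using K1 \<gamma> k0 by (intro mult_right_mono power_mono) auto
    then have "32 * real k / \<gamma> * t \<le> (K * sqrt t)\<^sup>2"
      using \<gamma> k0 t0 by (simp add: power_mult_distrib)
    also have "\<dots> \<le> (real j)\<^sup>2" using j1 K0 t0 by (intro power_mono) auto
    finally have j4: "32 * real k * t \<le> (real j)\<^sup>2 * \<gamma>" using \<gamma> by (simp add: field_simps)
    have "2 * k \<le> j" using j1 Kt by linarith
    then have "(real j)\<^sup>2 / (16 * real k) \<le> real (card (arith_progs k {1..j}))"
      using k3 by (intro card_arith_progs_ge) auto
    moreover have "p ^ k \<le> p ^ 1" using p0 p1 k3 by (intro power_decreasing) auto
    then have "\<gamma> \<le> 1 - p ^ k" using \<gamma> by simp
    ultimately have "(real j)\<^sup>2 / (16 * real k) * \<gamma> \<le> real (card (arith_progs k {1..j})) * (1 - p ^ k)"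
      using \<gamma> by (intro mult_mono) auto
    moreover have "2 * t \<le> (real j)\<^sup>2 / (16 * real k) * \<gamma>"
      using j4 k0 by (simp add: field_simps)
    ultimately have big: "2 * t \<le> real (card (arith_progs k {1..j})) * (1 - p ^ k)" by linarith
    have "V2 \<le> t\<^sup>2" using t by (rule sqrt_le_D)
    from jL bprob_plant[OF True t0 this big] show ?thesis by linarith
  next
    \<comment> \<open>A segment that does not fit into \<open>{1..n}\<close> is replaced by the
      whole set, which reaches the target by \<open>max\<close>; and
      \<open>p ^ n \<ge> p ^ j\<close>.\<close>
    case False
    have "p ^ j / 2 \<le> p ^ j" using p0 by simp
    also have "\<dots> \<le> p ^ card {1..n}" using False p0 p1 by (intro power_decreasing) auto
    also have "\<dots> = bprob {1..n} p (\<lambda>A. {1..n} \<subseteq> A)" by (rule bprob_supset[symmetric]) auto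
    also have "\<dots> \<le> bprob {1..n} p (\<lambda>A. edge_count H A \<ge> \<mu> + t)"
    proof (rule bprob_mono)
      fix A assume "A \<subseteq> {1..n}" "{1..n} \<subseteq> A"
      then have "A = {1..n}" by auto
      moreover have "{e \<in> H. e \<subseteq> {1..n}} = H" using arith_progs_Pow by blast
      ultimately show "edge_count H A \<ge> \<mu> + t" using max by (simp add: edge_count_def)
    qed (use p0 p1 in auto)
    finally show ?thesis using jL by linarith
  qed
qed

text \<open>\<open>(K - 1) * sqrt V2\<close> bounds the standard deviation at \<open>q\<close>, with
  \<open>4 ^ k\<close> coming from \<open>(1 + \<theta>) ^ (2 * k - 1)\<close>. For
  \<open>\<theta> = K * t / \<mu>\<close> the mean at \<open>q\<close> is at least
  \<open>\<mu> + K * t\<close>, so a Cantelli loss of \<open>(K - 1) * t\<close> still leaves the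
  target. The assumption \<open>small\<close> says \<open>\<theta> \<le> \<gamma>\<close>, which
  keeps \<open>q\<close> below 1.\<close>

lemma bprob_lower_tilt:
  assumes \<gamma>: "0 < \<gamma>" "p \<le> 1 - \<gamma>" and t: "sqrt V2 \<le> t"
    and K: "K = 1 + sqrt (2 * real k ^ 4 * 4 ^ k * (256 * real k / \<gamma>))"
    and small: "K * t \<le> \<gamma> * \<mu>"
  shows "exp (- (512 * real k ^ 6 * K\<^sup>2 / \<gamma> + 2) * (t\<^sup>2 / V2))
    \<le> bprob {1..n} p (\<lambda>A. edge_count H A \<ge> \<mu> + t)"
proof -
  have k0: "0 < real k" using k3 by simp
  have t0: "0 < t" using t V2_pos by (meson less_le_trans real_sqrt_gt_zero)
  have t2: "V2 \<le> t\<^sup>2" using t by (rule sqrt_le_D)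
  have K1: "1 < K" using \<gamma> k0 by (simp add: K)
  define \<theta> where "\<theta> = K * t / \<mu>"
  have \<theta>: "0 < \<theta>" "\<theta> \<le> \<gamma>" using small \<mu>_pos K1 t0 by (auto simp: \<theta>_def field_simps)
  define q where "q = p * (1 + \<theta>)"
  have pq: "p \<le> q" using p0 \<theta> by (simp add: q_def)
  have q0: "0 < q" using p0 pq by simp
  have "q \<le> (1 - \<gamma>) * (1 + \<gamma>)" unfolding q_def using p0 \<theta> \<gamma> by (intro mult_mono) auto
  also have "\<dots> < 1" using \<gamma> by (simp add: algebra_simps)
  finally have q1: "q < 1" .
  have \<gamma>1: "\<gamma> < 1" using \<gamma> p0 by simp
  have mq: "ln (real n) \<le> real n * q ^ (k - 1)"
    using ln_n power_mono[OF pq, of "k - 1"] p0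
      mult_left_mono[of "p ^ (k - 1)" "q ^ (k - 1)" "real n"] by simp
  interpret Q: random_APs k n q
    using k3 nk q0 q1 mq by unfold_locales
  have "1 + \<theta> \<le> 1 + real k * \<theta>" using \<theta> k3 by simp
  also have "\<dots> \<le> (1 + \<theta>) ^ k" using Bernoulli_inequality[of \<theta> k] \<theta> by simp
  finally have "\<mu> * (1 + \<theta>) \<le> \<mu> * (1 + \<theta>) ^ k" using \<mu>_pos by simp
  also have "\<dots> = Q.\<mu>" unfolding Q.\<mu>_def by (simp add: \<mu>_def q_def power_mult_distrib)
  finally have "\<mu> * (1 + \<theta>) \<le> Q.\<mu>" .
  moreover have "\<mu> * (1 + \<theta>) = \<mu> + K * t" using \<mu>_pos by (simp add: \<theta>_def distrib_left)
  ultimately have \<mu>q: "\<mu> + K * t \<le> Q.\<mu>" by linarith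
  have "edge_var H q \<le> 2 * real k ^ 4 * (real n ^ 3 * q ^ (2 * k - 1))"
    using Q.V2_upper unfolding Q.mY .
  also have "\<dots> \<le> 2 * real k ^ 4 * (real n ^ 3 * (4 ^ k * p ^ (2 * k - 1)))"
  proof (intro mult_left_mono)
    have "(1 + \<theta>) ^ (2 * k - 1) \<le> 2 ^ (2 * k - 1)"
      using \<theta> \<gamma>1 by (intro power_mono) auto
    also have "\<dots> \<le> (2 :: real) ^ (2 * k)" by (intro power_increasing) auto
    also have "\<dots> = 4 ^ k" by (simp add: power_mult)
    finally show "q ^ (2 * k - 1) \<le> 4 ^ k * p ^ (2 * k - 1)"
      using p0 by (simp add: q_def power_mult_distrib)
  qed auto
  also have "\<dots> = 2 * real k ^ 4 * 4 ^ k * (m * Y)" unfolding mY by simp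
  also have "\<dots> \<le> 2 * real k ^ 4 * 4 ^ k * ((256 * real k / \<gamma>) * V2)"
  proof (intro mult_left_mono)
    have "\<gamma> * (m * Y) \<le> (1 - p) * (m * Y)" using \<gamma> mY_ge_1 by (intro mult_right_mono) auto
    then have "\<gamma> * (m * Y) \<le> 256 * real k * V2" using V2_lower by linarith
    then show "m * Y \<le> (256 * real k / \<gamma>) * V2" using \<gamma> by (simp add: field_simps)
  qed auto
  also have "\<dots> = (K - 1)\<^sup>2 * V2" using \<gamma> by (simp add: K)
  also have "\<dots> \<le> ((K - 1) * t)\<^sup>2" using t2 by (simp add: power_mult_distrib mult_left_mono)
  finally have varq: "edge_var H q \<le> ((K - 1) * t)\<^sup>2" .
  have "1 / 2 \<le> bprob {1..n} q (\<lambda>A. edge_count H A \<ge> Q.\<mu> - (K - 1) * t)"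
    by (rule bprob_Cantelli_lower[of "{1..n}" q "(K - 1) * t" "edge_count H",
          unfolded Q.bexp_H Q.bexp_H_var])
       (use K1 t0 q0 q1 varq in auto)
  also have "\<dots> \<le> bprob {1..n} q (\<lambda>A. edge_count H A \<ge> \<mu> + t)"
    using q0 q1 \<mu>q by (intro bprob_mono) (auto simp: algebra_simps)
  finally have half: "1 / 2 \<le> bprob {1..n} q (\<lambda>A. edge_count H A \<ge> \<mu> + t)" .
  let ?P = "bprob {1..n} p (\<lambda>A. edge_count H A \<ge> \<mu> + t)"
  let ?x = "(q - p)\<^sup>2 / (p * (1 - p))"
  have x0: "0 \<le> ?x" using p0 p1 by simp
  have "(1 / 2)\<^sup>2 \<le> (bprob {1..n} q (\<lambda>A. edge_count H A \<ge> \<mu> + t))\<^sup>2"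
    by (intro power_mono half) simp
  also have "\<dots> \<le> (1 + ?x) ^ card {1..n} * ?P"
    using p0 p1 q0 q1 by (intro bprob_change_measure) auto
  also have "\<dots> \<le> exp (real n * ?x) * ?P"
  proof (intro mult_right_mono)
    have "(1 + ?x) ^ card {1..n} \<le> exp ?x ^ card {1..n}"
      using x0 by (intro power_mono) auto
    then show "(1 + ?x) ^ card {1..n} \<le> exp (real n * ?x)"
      by (simp only: exp_of_nat_mult card_atLeastAtMost diff_Suc_1)
  qed (use p0 p1 in \<open>auto intro: bprob_nonneg\<close>)
  finally have quarter: "1 / 4 \<le> exp (real n * ?x) * ?P" by (simp add: power2_eq_square)
  \<comment> \<open>The cost \<open>n * p * \<theta>^2\<close> is of order
    \<open>n * p * t^2 / \<mu>^2\<close>; \<open>Y_sq\<close> identifies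
    \<open>Y^2 / (n * p)\<close> with \<open>m * Y\<close>, the order of the variance.\<close>
  have "(q - p)\<^sup>2 = p * (p * \<theta>\<^sup>2)" by (simp add: q_def power2_eq_square algebra_simps)
  then have "?x = p * \<theta>\<^sup>2 / (1 - p)" using p0 by simp
  also have "\<dots> \<le> p * \<theta>\<^sup>2 / \<gamma>" using p0 p1 \<gamma> by (intro divide_left_mono) auto
  finally have "real n * ?x \<le> real n * (p * \<theta>\<^sup>2 / \<gamma>)" by (intro mult_left_mono) auto
  also have "\<dots> = K\<^sup>2 * t\<^sup>2 / \<gamma> * (real n * p) / \<mu>\<^sup>2"
    by (simp add: \<theta>_def power_divide power_mult_distrib mult_ac)
  also have "\<dots> \<le> K\<^sup>2 * t\<^sup>2 / \<gamma> * (real n * p) / (Y / (16 * real k))\<^sup>2"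
    using Y_le_\<mu> Y_pos k0 \<gamma> p0 \<mu>_pos
    by (intro divide_left_mono power_mono mult_pos_pos zero_less_power mult_nonneg_nonneg)
       (auto simp: field_simps)
  also have "\<dots> = 256 * real k ^ 2 * K\<^sup>2 / \<gamma> * t\<^sup>2 * ((real n * p) / Y\<^sup>2)"
    by (simp add: power_divide power_mult_distrib)
  also have "(real n * p) / Y\<^sup>2 = 1 / (m * Y)"
    unfolding Y_sq using p0 k3 nk by simp
  also have "256 * real k ^ 2 * K\<^sup>2 / \<gamma> * t\<^sup>2 * (1 / (m * Y))
      \<le> 256 * real k ^ 2 * K\<^sup>2 / \<gamma> * t\<^sup>2 * (2 * real k ^ 4 / V2)"
    using V2_upper V2_pos mY_ge_1 \<gamma> by (intro mult_left_mono) (auto simp: field_simps)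
  also have "\<dots> = 512 * real k ^ 6 * K\<^sup>2 / \<gamma> * (t\<^sup>2 / V2)"
    by (simp flip: power_add)
  finally have ent: "real n * ?x \<le> 512 * real k ^ 6 * K\<^sup>2 / \<gamma> * (t\<^sup>2 / V2)" .
  \<comment> \<open>The squared probability 1/2 leaves a factor 1/4, at least
    \<open>exp (- 2)\<close>; as \<open>t^2 / V2 \<ge> 1\<close>, the summand 2 in the constant
    absorbs it.\<close>
  have "1 \<le> t\<^sup>2 / V2" using t2 V2_pos by simp
  then have "- (512 * real k ^ 6 * K\<^sup>2 / \<gamma> + 2) * (t\<^sup>2 / V2) \<le> - (real n * ?x) - 2"
    using ent by (simp only: distrib_right minus_add_distrib mult_minus_left)
  then have "exp (- (512 * real k ^ 6 * K\<^sup>2 / \<gamma> + 2) * (t\<^sup>2 / V2)) \<le> exp (- (real n * ?x) - 2)"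
    by simp
  also have "\<dots> = exp (- (real n * ?x)) * (1 / exp 2)" by (simp add: exp_diff)
  also have "\<dots> \<le> exp (- (real n * ?x)) * (1 / 4)"
  proof -
    have "(2 :: real) * 2 \<le> exp 1 * exp 1"
      using exp_ge_add_one_self[of 1] by (intro mult_mono) auto
    then show ?thesis by (intro mult_left_mono) (auto simp: field_simps simp flip: exp_add)
  qed
  also have "\<dots> \<le> exp (- (real n * ?x)) * (exp (real n * ?x) * ?P)"
    by (intro mult_left_mono quarter) auto
  also have "\<dots> = ?P" by (simp flip: exp_add mult.assoc)
  finally show ?thesis .
qed

text \<open>Here \<open>Y\<close> is at most of order \<open>t\<close>, so \<open>mL_le\<close>
  bounds \<open>m * L\<close> by the order of \<open>sqrt t\<close>, and
  \<open>V2 * sqrt t * L\<close> is at most of order \<open>t^2\<close>. Planting alone therefore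
  suffices for \<open>t\<close> too large to tilt.\<close>

lemma rate_min_large_t:
  assumes \<epsilon>: "0 < \<epsilon>" "\<epsilon> \<le> 1" and t: "\<epsilon> * \<mu> \<le> t"
  shows "sqrt t * L \<le> 4 * real k ^ 4 * (16 * real k / \<epsilon>)\<^sup>2 * (t\<^sup>2 / V2)"
proof -
  have k0: "0 < real k" using k3 by simp
  define Q where "Q = 16 * real k / \<epsilon>"
  have Q1: "1 \<le> Q" using \<epsilon> k3 by (simp add: Q_def field_simps)
  have t0: "0 < t" using t \<epsilon> \<mu>_pos by (meson less_le_trans mult_pos_pos)
  have "\<epsilon> * Y \<le> \<epsilon> * (16 * real k * \<mu>)" using \<epsilon> Y_le_\<mu> by (intro mult_left_mono) auto
  also have "\<dots> = 16 * real k * (\<epsilon> * \<mu>)" by simp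
  also have "\<dots> \<le> 16 * real k * t" using t by (intro mult_left_mono) auto
  finally have YQ: "Y \<le> Q * t" using \<epsilon> by (simp add: Q_def field_simps)
  have "sqrt Y \<le> sqrt Q * sqrt t" using YQ by (simp flip: real_sqrt_mult)
  also have "\<dots> \<le> Q * sqrt t"
    using Q1 t0 by (intro mult_right_mono) (auto simp: real_le_lsqrt power2_eq_square)
  finally have sY: "sqrt Y \<le> Q * sqrt t" .
  have mLQ: "m * L \<le> 2 * (Q * sqrt t)" using mL_le sY by linarith
  have "V2 * (sqrt t * L) \<le> 2 * real k ^ 4 * (m * Y) * (sqrt t * L)"
    using V2_upper t0 L_pos by (intro mult_right_mono) auto
  also have "\<dots> = 2 * real k ^ 4 * sqrt t * (m * L) * Y" by simp
  also have "\<dots> \<le> 2 * real k ^ 4 * sqrt t * (2 * (Q * sqrt t)) * (Q * t)"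
    by (intro mult_mono[OF mult_left_mono[OF mLQ] YQ]) (use t0 Q1 Y_pos in auto)
  also have "\<dots> = 4 * real k ^ 4 * Q\<^sup>2 * t\<^sup>2"
    using t0 by (simp add: power2_eq_square)
  finally have "sqrt t * L * V2 \<le> 4 * real k ^ 4 * Q\<^sup>2 * t\<^sup>2" by (simp add: mult_ac)
  then have "sqrt t * L \<le> 4 * real k ^ 4 * Q\<^sup>2 * t\<^sup>2 / V2" by (simp only: pos_le_divide_eq[OF V2_pos])
  then show ?thesis by (simp only: Q_def times_divide_eq_right)
qed

end

section \<open>Upper bounds for the upper tail\<close>

lemma nat_ceiling_le_twice:
  fixes x :: real
  assumes "1 \<le> x"
  shows "1 \<le> nat \<lceil>x\<rceil>" "x \<le> real (nat \<lceil>x\<rceil>)" "real (nat \<lceil>x\<rceil>) \<le> 2 * x"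
  using assms by linarith+

lemma nat_floor_ge_half:
  fixes x :: real
  assumes "1 \<le> x"
  shows "x / 2 \<le> real (nat \<lfloor>x\<rfloor>)"
proof -
  have "1 \<le> \<lfloor>x\<rfloor>" using assms by simp
  then show ?thesis by linarith
qed

text \<open>With \<open>a\<close> proportional to the cost of deleting one star,
  \<open>Suc (nat \<lfloor>x / a\<rfloor>)\<close> is the number of disjoint stars to forbid: one
  star fewer is cheap to delete, while this many are unlikely.\<close>

lemma real_Suc_floor_bounds:
  fixes x a :: real
  assumes "0 < a" "0 \<le> x"
  shows "real (Suc (nat \<lfloor>x / a\<rfloor>) - 1) * a \<le> x" "x \<le> real (Suc (nat \<lfloor>x / a\<rfloor>)) * a"
proof -
  have "0 \<le> x / a" using assms by simp
  then have "real (nat \<lfloor>x / a\<rfloor>) \<le> x / a" "x / a \<le> real (Suc (nat \<lfloor>x / a\<rfloor>))" by linarith+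
  then show "real (Suc (nat \<lfloor>x / a\<rfloor>) - 1) * a \<le> x" "x \<le> real (Suc (nat \<lfloor>x / a\<rfloor>)) * a"
    using assms by (simp_all only: diff_Suc_1 pos_le_divide_eq pos_divide_le_eq)
qed

lemma one_plus_ge_exp:
  fixes x :: real
  assumes "0 \<le> x"
  shows "exp (min x 1 / 2) \<le> 1 + x"
  using real_exp_bound_lemma[of "min x 1 / 2"] assms by auto

text \<open>Removes the leading constant 6: for small \<open>x\<close> the bound 1/2 is below
  \<open>exp (- x / 4)\<close>, and otherwise \<open>exp (3 * x / 4) \<ge> 8\<close>.\<close>

lemma le_exp_if_le_half:
  fixes P x :: real
  assumes "0 \<le> x" "P \<le> 1 / 2" "P \<le> 6 * exp (- x)"
  shows "P \<le> exp (- x / 4)"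
proof (cases "x / 4 \<le> ln 2")
  case True
  then have "exp (- ln 2) \<le> exp (- x / 4)" by simp
  then show ?thesis using assms(2) by (simp add: exp_minus)
next
  case False
  then have "exp (ln 2) \<le> exp (x / 4)" by (simp only: exp_le_cancel_iff not_le less_imp_le)
  then have 2: "2 \<le> exp (x / 4)" by (subst (asm) exp_ln) auto
  have "(2 :: real) ^ 3 \<le> exp (x / 4) ^ 3" by (intro power_mono 2) auto
  also have "\<dots> = exp (3 * (x / 4))" by (simp flip: exp_of_nat_mult)
  finally have "6 * exp (- x) \<le> exp (3 * (x / 4)) * exp (- x)" by (intro mult_right_mono) auto
  also have "\<dots> = exp (- x / 4)" by (simp flip: exp_add)
  finally show ?thesis using assms(3) by linarith
qed

context random_APs
begin

definition "B = real k * exp 2"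

text \<open>If all degrees are at most \<open>k * s * (k * k)\<close>, an edge meets at most
  \<open>k ^ 4 * s\<close> edges; \<open>s \<le> 2 * B * m\<close> turns this into
  \<open>E * m\<close>. \<open>B\<close> is the constant required by
  \<open>bprob_disjoint_stars_exp\<close>.\<close>

definition "E = 2 * real k ^ 4 * B"

definition "R t = min (t\<^sup>2 / (m * Y)) (sqrt t * L)"

abbreviation no_stars :: "nat \<Rightarrow> nat \<Rightarrow> nat set set \<Rightarrow> bool" where
  "no_stars s r J \<equiv> disjoint_lists (Union ` stars J s) r = {}"

lemma B_ge: "2 \<le> B"
proof -
  have "1 * 2 \<le> real k * exp 2"
    using k3 exp_ge_add_one_self[of 2] by (intro mult_mono) auto
  then show ?thesis by (simp add: B_def)
qed

lemma E_ge: "1 \<le> E"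
proof -
  have "1 * 1 * 1 \<le> 2 * real k ^ 4 * B"
    using k3 B_ge by (intro mult_mono one_le_power) (auto intro: one_le_power)
  then show ?thesis by (simp add: E_def)
qed

lemma R_nonneg: "0 < t \<Longrightarrow> 0 \<le> R t"
  using L_pos mY_ge_1 by (simp add: R_def)

lemma bprob_stars:
  assumes "1 \<le> s" "B * m * \<rho> \<le> real s" "1 \<le> \<rho>"
  shows "bprob {1..n} p (\<lambda>A. \<not> no_stars s r {e \<in> H. e \<subseteq> A})
    \<le> exp (- (real r * real s / 2) * (1 + ln \<rho>))"
proof (rule bprob_disjoint_stars_exp)
  show "card {e \<in> H. v \<in> e} \<le> k * card {1..n}" for v
    using arith_progs_degree[of k n v] k3 by simp
  show "m = real (card {1..n}) * p ^ (k - 1)" by (simp add: m_def)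
  show "real (card {1..n}) \<le> exp m" using n_le_exp_m by simp
qed (use H_simps p0 p1 k3 m_ge_1 assms in \<open>auto simp: B_def\<close>)

lemma no_stars_subset:
  assumes "no_stars s r J" "J' \<subseteq> J"
  shows "no_stars s r J'"
proof -
  have "stars J' s \<subseteq> stars J s" using assms(2) unfolding stars_def by blast
  then have "disjoint_lists (Union ` stars J' s) r \<subseteq> disjoint_lists (Union ` stars J s) r"
    by (intro disjoint_lists_mono image_mono)
  then show ?thesis using assms(1) by simp
qed

lemma reduce_H:
  assumes J: "J \<subseteq> H" and none: "no_stars s r J" and d: "\<And>v. card {e \<in> J. v \<in> e} \<le> d"
  shows "\<exists>J'\<subseteq>J. card (J - J') \<le> (r - 1) * (k * s) * d \<and> (\<forall>v. card {e \<in> J'. v \<in> e} \<le> k * s * (k * k))"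
proof (rule degree_reduction)
  show "card {e \<in> J. u \<in> e \<and> v \<in> e} \<le> k * k" if "u \<noteq> v" for u v
  proof -
    have "card {e \<in> J. u \<in> e \<and> v \<in> e} \<le> card {e \<in> H. u \<in> e \<and> v \<in> e}"
      using J H_simps(1) by (intro card_mono) auto
    also have "\<dots> \<le> k * k" using k3 that by (intro arith_progs_codegree) auto
    finally show ?thesis .
  qed
  show "finite J" using J H_simps(1) finite_subset by blast
  show "finite e \<and> card e = k" if "e \<in> J" for e using that J H_simps(3,4) by blast
qed (use k3 none d in auto)

text \<open>For \<open>t < 4 * E * m\<close> the right-hand side is at least 1. Otherwise lists of
  length about \<open>t / (4 * E * m)\<close> give the Gaussian exponent while
  \<open>t \<le> 4 * \<mu>\<close>; beyond that the exponent is of order \<open>t / m\<close>, which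
  dominates \<open>sqrt t * L\<close> by \<open>mL_le\<close>.\<close>

lemma bprob_low_degree:
  assumes t: "0 < t"
  shows "bprob {1..n} p (\<lambda>A. \<exists>J\<subseteq>{e \<in> H. e \<subseteq> A}. real (card J) \<ge> \<mu> + t / 2
      \<and> (\<forall>e\<in>J. real (card {f \<in> J. f \<inter> e \<noteq> {}}) \<le> E * m)) \<le> exp (1 - R t / (64 * real k * E\<^sup>2))"
    (is "?P \<le> _")
proof (cases "t < 4 * (E * m)")
  case True
  have "t\<^sup>2 \<le> (4 * (E * m))\<^sup>2" using True t by (intro power_mono) auto
  also have "\<dots> = 16 * E\<^sup>2 * (m * m)" by (simp add: power_mult_distrib power2_eq_square)
  also have "\<dots> \<le> 16 * E\<^sup>2 * (m * Y)"
  proof (intro mult_left_mono)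
    have "p ^ k = p ^ (k - 1) * p" using k3 by (cases k) auto
    then have "Y = m * (real n * p)" by (simp add: m_def Y_def power2_eq_square)
    then show "m \<le> Y" using m_ge_1 m_le_np mult_left_mono[of 1 "real n * p" m] by simp
  qed (use m_ge_1 in auto)
  finally have "t\<^sup>2 / (m * Y) \<le> 16 * E\<^sup>2" using mY_ge_1 by (simp add: field_simps)
  then have "R t \<le> 16 * E\<^sup>2" by (simp add: R_def)
  also have "\<dots> \<le> 64 * real k * E\<^sup>2" using k3 by (intro mult_right_mono) auto
  finally have "R t / (64 * real k * E\<^sup>2) \<le> 1" using E_ge k3 by (simp add: field_simps)
  then have "1 \<le> exp (1 - R t / (64 * real k * E\<^sup>2))" by simp
  moreover have "?P \<le> 1" using p0 p1 by (intro bprob_le_1) auto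
  ultimately show ?thesis by linarith
next
  case False
  have Em: "1 \<le> E * m" using E_ge m_ge_1 mult_mono[of 1 E 1 m] by simp
  define s where "s = nat \<lfloor>t / (4 * (E * m))\<rfloor>"
  have x1: "1 \<le> t / (4 * (E * m))" using False Em by simp
  have s1: "real s \<le> t / (4 * (E * m))" unfolding s_def using x1 by linarith
  have "t / (4 * (E * m)) / 2 \<le> real s" unfolding s_def by (rule nat_floor_ge_half[OF x1])
  then have s2: "t / (8 * (E * m)) \<le> real s" by simp
  define x where "x = t / (4 * \<mu>)"
  have x0: "0 < x" using t \<mu>_pos by (simp add: x_def)
  have "real s * (E * m) \<le> t / 2 / 2" using s1 Em by (simp add: field_simps)
  then have "?P \<le> (\<mu> / (\<mu> + t / 2 / 2)) ^ s"
    using H_simps p0 p1 t Em by (intro bprob_bounded_degree_upper_tail) (auto simp: \<mu>_def)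
  also have "\<mu> / (\<mu> + t / 2 / 2) = 1 / (1 + x)" using \<mu>_pos t by (simp add: x_def field_simps)
  also have "(1 / (1 + x)) ^ s \<le> exp (- (min x 1 / 2)) ^ s"
    using one_plus_ge_exp[of x] x0
    by (intro power_mono) (auto simp: exp_minus field_simps)
  also have "\<dots> = exp (- (real s * (min x 1 / 2)))" by (simp flip: exp_of_nat_mult)
  also have "\<dots> \<le> exp (1 - R t / (64 * real k * E\<^sup>2))"
  proof -
    have E2: "64 * real k * E \<le> 64 * real k * E\<^sup>2"
      using E_ge by (intro mult_left_mono) (auto simp: power2_eq_square)
    have R2: "R t / (64 * real k * E\<^sup>2) \<le> R t / (64 * real k * E)"
      using E2 R_nonneg[OF t] E_ge k3 by (intro divide_left_mono) auto
    have "R t / (64 * real k * E) \<le> t / (8 * (E * m)) * (min x 1 / 2)"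
    proof (cases "x \<le> 1")
      case True
      have "R t \<le> t\<^sup>2 / (m * Y)" by (simp add: R_def)
      also have "\<dots> \<le> t\<^sup>2 / (m * \<mu>)"
        using \<mu>_le_Y \<mu>_pos m_ge_1 by (intro divide_left_mono mult_left_mono) auto
      finally have "R t / (64 * real k * E) \<le> t\<^sup>2 / (m * \<mu>) / (64 * real k * E)"
        using E_ge k3 by (intro divide_right_mono) auto
      also have "\<dots> \<le> t\<^sup>2 / (m * \<mu>) / (64 * E)"
        using E_ge k3 m_ge_1 \<mu>_pos by (intro divide_left_mono) auto
      also have "\<dots> = t / (8 * (E * m)) * (min x 1 / 2)"
        using True by (simp add: x_def power2_eq_square)
      finally show ?thesis .
    next
      case False
      then have "4 * \<mu> \<le> t" using \<mu>_pos by (simp add: x_def field_simps)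
      then have "4 * real k * (4 * \<mu>) \<le> 4 * real k * t" by (intro mult_left_mono) auto
      then have Yt: "Y \<le> 4 * real k * t" using Y_le_\<mu> by linarith
      also have "\<dots> \<le> (2 * real k)\<^sup>2 * t"
        using k3 t by (intro mult_right_mono) (auto simp: power2_eq_square)
      finally have "sqrt Y \<le> 2 * real k * sqrt t"
        using t by (intro real_le_lsqrt) (auto simp: power_mult_distrib)
      then have "m * L \<le> 4 * real k * sqrt t" using mL_le by linarith
      then have "sqrt t * (m * L) \<le> sqrt t * (4 * real k * sqrt t)"
        using t by (intro mult_left_mono[of "m * L"]) auto
      also have "\<dots> = 4 * real k * (sqrt t * sqrt t)" by (simp only: mult_ac)
      also have "\<dots> = 4 * real k * t" using t by simp
      finally have "sqrt t * L * m \<le> 4 * real k * t" by (simp only: mult_ac)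
      then have "sqrt t * L \<le> 4 * real k * t / m" using m_ge_1 by (simp add: field_simps)
      then have "R t \<le> 4 * real k * t / m" by (simp add: R_def)
      then have "R t / (64 * real k * E) \<le> 4 * real k * t / m / (64 * real k * E)"
        using E_ge k3 by (intro divide_right_mono) auto
      also have "\<dots> = t / (16 * (E * m))" using k3 by simp
      also have "\<dots> = t / (8 * (E * m)) * (min x 1 / 2)" using False by simp
      finally show ?thesis .
    qed
    also have "\<dots> \<le> real s * (min x 1 / 2)" using x0 by (intro mult_right_mono s2) auto
    finally show ?thesis using R2 by simp
  qed
  finally show ?thesis .
qed

text \<open>The excess is shared: at most \<open>t / 2\<close> edges are deleted, and the surviving
  family of bounded degree still has at least \<open>\<mu> + t / 2\<close> members.\<close>

lemma bprob_upper_aux: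
  assumes t: "0 < t" and s: "real s \<le> 2 * (B * m)"
    and red: "\<And>A. A \<subseteq> {1..n} \<Longrightarrow> \<not> Bad A \<Longrightarrow> \<exists>J\<subseteq>{e \<in> H. e \<subseteq> A}.
      real (card ({e \<in> H. e \<subseteq> A} - J)) \<le> t / 2 \<and> (\<forall>v. card {e \<in> J. v \<in> e} \<le> k * s * (k * k))"
  shows "bprob {1..n} p (\<lambda>A. edge_count H A \<ge> \<mu> + t)
    \<le> bprob {1..n} p Bad + exp (1 - R t / (64 * real k * E\<^sup>2))"
proof -
  let ?Q = "\<lambda>A. \<exists>J\<subseteq>{e \<in> H. e \<subseteq> A}. real (card J) \<ge> \<mu> + t / 2
      \<and> (\<forall>e\<in>J. real (card {f \<in> J. f \<inter> e \<noteq> {}}) \<le> E * m)"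
  have "bprob {1..n} p (\<lambda>A. edge_count H A \<ge> \<mu> + t) \<le> bprob {1..n} p (\<lambda>A. Bad A \<or> ?Q A)"
  proof (rule bprob_mono)
    fix A assume A: "A \<subseteq> {1..n}" "edge_count H A \<ge> \<mu> + t"
    show "Bad A \<or> ?Q A"
    proof (cases "Bad A")
      case False
      let ?J0 = "{e \<in> H. e \<subseteq> A}"
      obtain J where J: "J \<subseteq> ?J0" "real (card (?J0 - J)) \<le> t / 2"
        "\<And>v. card {e \<in> J. v \<in> e} \<le> k * s * (k * k)"
        using red[OF A(1) False] by blast
      have fin: "finite ?J0" using H_simps(1) by simp
      have finJ: "finite J" using J(1) fin by (rule finite_subset)
      have "card ?J0 = card (?J0 - J) + card J"
        using card_Diff_subset[OF finJ J(1)] card_mono[OF fin J(1)] by simp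
      then have "\<mu> + t / 2 \<le> real (card J)" using A(2) J(2) by (simp add: edge_count_def)
      moreover have "real (card {f \<in> J. f \<inter> e \<noteq> {}}) \<le> E * m" if e: "e \<in> J" for e
      proof -
        have "e \<in> H" using e J(1) by auto
        then have "card {f \<in> J. f \<inter> e \<noteq> {}} \<le> k * (k * s * (k * k))"
          using H_simps J(3) finJ by (intro card_meeting_le) auto
        then have "real (card {f \<in> J. f \<inter> e \<noteq> {}}) \<le> real (k * (k * s * (k * k)))" by (rule of_nat_mono)
        also have "\<dots> = real k ^ 4 * real s" by (simp add: power4_eq_xxxx)
        also have "\<dots> \<le> real k ^ 4 * (2 * (B * m))" by (intro mult_left_mono s) auto
        finally show ?thesis by (simp add: E_def mult_ac)
      qed
      ultimately show ?thesis using J(1) by blast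
    qed simp
  qed (use p0 p1 in auto)
  also have "\<dots> \<le> bprob {1..n} p Bad + bprob {1..n} p ?Q"
    using p0 p1 by (intro bprob_disj) auto
  also have "\<dots> \<le> bprob {1..n} p Bad + exp (1 - R t / (64 * real k * E\<^sup>2))"
    by (intro add_left_mono bprob_low_degree t)
  finally show ?thesis .
qed

text \<open>In this range \<open>R t \<le> m\<close>, so a single star of size at least
  \<open>B * m\<close> is already unlikely enough. With \<open>r = 1\<close> nothing is deleted,
  which is why the crude degree bound \<open>card H\<close> suffices.\<close>

lemma bprob_upper_small:
  assumes t: "0 < t" and small: "t\<^sup>2 \<le> m\<^sup>2 * Y"
  shows "bprob {1..n} p (\<lambda>A. edge_count H A \<ge> \<mu> + t) \<le> exp (- R t) + exp (1 - R t / (64 * real k * E\<^sup>2))"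
proof -
  define s where "s = nat \<lceil>B * m\<rceil>"
  have Bm: "1 \<le> B * m" using B_ge m_ge_1 mult_mono[of 1 B 1 m] by simp
  note s = nat_ceiling_le_twice[OF Bm, folded s_def]
  let ?Bad = "\<lambda>A. \<not> no_stars s 1 {e \<in> H. e \<subseteq> A}"
  have "bprob {1..n} p (\<lambda>A. edge_count H A \<ge> \<mu> + t)
      \<le> bprob {1..n} p ?Bad + exp (1 - R t / (64 * real k * E\<^sup>2))"
  proof (rule bprob_upper_aux[OF t s(3)])
    fix A assume "\<not> ?Bad A"
    then have "\<exists>J\<subseteq>{e \<in> H. e \<subseteq> A}. card ({e \<in> H. e \<subseteq> A} - J) \<le> (1 - 1) * (k * s) * card H
        \<and> (\<forall>v. card {e \<in> J. v \<in> e} \<le> k * s * (k * k))"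
      using H_simps(1) by (intro reduce_H card_mono) auto
    then obtain J where J: "J \<subseteq> {e \<in> H. e \<subseteq> A}"
      "card ({e \<in> H. e \<subseteq> A} - J) \<le> (1 - 1) * (k * s) * card H"
      "\<forall>v. card {e \<in> J. v \<in> e} \<le> k * s * (k * k)" by (elim exE conjE)
    have "real (card ({e \<in> H. e \<subseteq> A} - J)) \<le> t / 2"
      using of_nat_mono[OF J(2), where 'a = real] t by (simp only: diff_self_eq_0)
    then show "\<exists>J\<subseteq>{e \<in> H. e \<subseteq> A}. real (card ({e \<in> H. e \<subseteq> A} - J)) \<le> t / 2
        \<and> (\<forall>v. card {e \<in> J. v \<in> e} \<le> k * s * (k * k))"
      using J(1,3) by (intro exI[of _ J] conjI)
  qed
  moreover have "bprob {1..n} p ?Bad \<le> exp (- R t)"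
  proof -
    have "bprob {1..n} p ?Bad \<le> exp (- (real 1 * real s / 2) * (1 + ln 1))"
      using s by (intro bprob_stars) auto
    also have "\<dots> \<le> exp (- R t)"
    proof -
      have "t\<^sup>2 \<le> m * (m * Y)" using small by (simp add: power2_eq_square)
      then have "R t \<le> m" using mY_ge_1 by (simp add: R_def min_le_iff_disj pos_divide_le_eq)
      also have "2 * m \<le> real s" using s(2) B_ge m_ge_1 mult_right_mono[of 2 B m] by linarith
      finally show ?thesis by simp
    qed
    finally show ?thesis .
  qed
  ultimately show ?thesis by linarith
qed

text \<open>Three scales of stars. Stars of size about \<open>\<surd>t\<close> do not occur at all; then
  deleting the edges that touch a maximal family of disjoint stars of the next smaller scale costs
  at most \<open>t / 4\<close> edges per scale, because a larger family of disjoint stars would be too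
  unlikely. The intermediate scale gains the factor \<open>ln (1 / p)\<close>, which a direct passage
  from \<open>\<surd>t\<close> to \<open>m\<close> would lose.\<close>

lemma bprob_upper_large:
  assumes t: "0 < t" and large: "m\<^sup>2 * Y < t\<^sup>2"
  shows "bprob {1..n} p (\<lambda>A. edge_count H A \<ge> \<mu> + t)
    \<le> 3 * exp (- R t / (64 * E)) + exp (1 - R t / (64 * real k * E\<^sup>2))"
proof -
  \<comment> \<open>\<open>w\<close> is \<open>p\<close> to the power -1/4, the exponent that
    \<open>m_le\<close> permits: \<open>(m * w)^2 = m * (m / sqrt p) \<le> m * sqrt Y < t\<close>.
    Its root \<open>z\<close> places the middle scale \<open>sqrt t / z\<close> at least a factor
    \<open>z\<close> above \<open>m\<close>.\<close>
  define w where "w = sqrt (sqrt (1 / p))"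
  define z where "z = sqrt w"
  have w1: "1 \<le> w" using p0 p1 by (simp add: w_def)
  have z1: "1 \<le> z" using w1 by (simp add: z_def)
  have zz: "w = z * z" using w1 by (simp add: z_def)
  have lnw: "ln w = L / 4" using p0 by (simp add: w_def L_def ln_sqrt)
  have lnz: "ln z = L / 8" using w1 lnw by (simp add: z_def ln_sqrt)
  have zL: "L / 8 \<le> z" using ln_le_minus_one[of z] z1 lnz by simp
  have mw: "m * w \<le> sqrt t"
  proof -
    have "w * w = sqrt (1 / p)" using p0 by (simp add: w_def)
    then have "w * w = 1 / sqrt p" by (simp add: real_sqrt_divide)
    moreover have "m * w * (m * w) = m * (m * (w * w))" by (simp only: mult_ac)
    ultimately have "m * w * (m * w) = m * (m * (1 / sqrt p))" by (simp only:)
    also have "m * (1 / sqrt p) \<le> sqrt Y" using m_le p0 by (simp add: field_simps)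
    then have "m * (m * (1 / sqrt p)) \<le> m * sqrt Y" using m_ge_1 by (intro mult_left_mono) auto
    also have "\<dots> = sqrt (m\<^sup>2 * Y)" using m_ge_1 by (simp add: real_sqrt_mult)
    also have "\<dots> \<le> sqrt (t\<^sup>2)" using large by (intro real_sqrt_le_mono) simp
    finally have "(m * w)\<^sup>2 \<le> t" using t by (simp add: power2_eq_square)
    then show ?thesis by (rule real_le_rsqrt)
  qed
  have mz: "m * z \<le> sqrt t / z" using mw z1 zz by (simp add: field_simps)
  have st: "1 \<le> sqrt t" using mw m_ge_1 w1 mult_mono[of 1 m 1 w] by linarith
  have stz: "1 \<le> sqrt t / z" using mz m_ge_1 z1 mult_mono[of 1 m 1 z] by linarith
  have Bge1: "1 \<le> B * x" if "1 \<le> x" for x using B_ge that mult_mono[of 1 B 1 x] by simp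
  define s0 where "s0 = nat \<lceil>B * sqrt t\<rceil>"
  define s1 where "s1 = nat \<lceil>B * (sqrt t / z)\<rceil>"
  define s2 where "s2 = nat \<lceil>B * m\<rceil>"
  note s0 = nat_ceiling_le_twice[OF Bge1[OF st], folded s0_def]
  note s1 = nat_ceiling_le_twice[OF Bge1[OF stz], folded s1_def]
  note s2 = nat_ceiling_le_twice[OF Bge1[OF m_ge_1], folded s2_def]
  \<comment> \<open>A star of size \<open>s1\<close> has at most \<open>k * s1\<close> points of
    degree at most \<open>k ^ 3 * s0\<close>, so deleting its edges costs at most
    \<open>a1 / 4\<close>; \<open>a2\<close> plays the same role one scale lower.\<close>
  define a1 where "a1 = 4 * real k ^ 4 * (real s0 * real s1)"
  define a2 where "a2 = 4 * real k ^ 4 * (real s1 * real s2)"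
  have a0: "0 < a1" "0 < a2" using s0(1) s1(1) s2(1) k3 by (simp_all add: a1_def a2_def)
  define r1 where "r1 = Suc (nat \<lfloor>t / a1\<rfloor>)"
  define r2 where "r2 = Suc (nat \<lfloor>t / a2\<rfloor>)"
  note r1 = real_Suc_floor_bounds[OF a0(1) less_imp_le[OF t], folded r1_def]
  note r2 = real_Suc_floor_bounds[OF a0(2) less_imp_le[OF t], folded r2_def]
  let ?J0 = "\<lambda>A. {e \<in> H. e \<subseteq> A}"
  let ?B0 = "\<lambda>A. \<not> no_stars s0 1 (?J0 A)"
  let ?B1 = "\<lambda>A. \<not> no_stars s1 r1 (?J0 A)"
  let ?B2 = "\<lambda>A. \<not> no_stars s2 r2 (?J0 A)"
  have R: "R t \<le> sqrt t * L" by (simp add: R_def)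
  have B1: "1 \<le> B" using B_ge by simp
  have k4B: "1 \<le> real k ^ 4 * B"
    using k3 B_ge mult_mono[of 1 "real k ^ 4" 1 B] one_le_power[of "real k" 4] by simp
  have E': "64 * E = 128 * (real k ^ 4 * B)" by (simp add: E_def)
  have final: "exp (- y) \<le> exp (- R t / (64 * E))" if "sqrt t * L / (128 * (real k ^ 4 * B)) \<le> y" for y
  proof -
    have "R t / (64 * E) \<le> sqrt t * L / (128 * (real k ^ 4 * B))"
      unfolding E' using k4B R by (intro divide_right_mono) auto
    then show ?thesis using that by simp
  qed
  have P0: "bprob {1..n} p ?B0 \<le> exp (- R t / (64 * E))"
  proof -
    have "B * (m * w) \<le> B * sqrt t" using B1 by (intro mult_left_mono mw) simp
    then have "B * m * w \<le> real s0" using s0(2) by (simp only: mult.assoc)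
    then have "bprob {1..n} p ?B0 \<le> exp (- (real 1 * real s0 / 2) * (1 + ln w))"
      using s0 w1 by (intro bprob_stars) auto
    also have "\<dots> = exp (- (real s0 / 2 * (1 + L / 4)))" by (simp add: lnw)
    also have "\<dots> \<le> exp (- R t / (64 * E))"
    proof (rule final)
      have "1 * sqrt t \<le> B * sqrt t" using B1 t by (intro mult_right_mono) auto
      then have "sqrt t \<le> real s0" using s0(2) by linarith
      then have "sqrt t / 2 * (L / 4) \<le> real s0 / 2 * (1 + L / 4)"
        using L_pos t by (intro mult_mono) auto
      moreover have "sqrt t * L / (128 * (real k ^ 4 * B)) \<le> sqrt t * L / 8"
      proof (rule divide_left_mono)
        show "8 \<le> 128 * (real k ^ 4 * B)" "0 < 128 * (real k ^ 4 * B) * 8" using k4B by linarith+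
      qed (use L_pos t in auto)
      ultimately show "sqrt t * L / (128 * (real k ^ 4 * B)) \<le> real s0 / 2 * (1 + L / 4)" by simp
    qed
    finally show ?thesis .
  qed
  \<comment> \<open>The product \<open>r1 * s1\<close> is at least of order \<open>sqrt t\<close>,
    and the logarithm comes from \<open>ln z = L / 8\<close>.\<close>
  have P1: "bprob {1..n} p ?B1 \<le> exp (- R t / (64 * E))"
  proof -
    have "B * (m * z) \<le> B * (sqrt t / z)" using B1 by (intro mult_left_mono mz) simp
    then have "B * m * z \<le> real s1" using s1(2) by (simp only: mult.assoc)
    then have "bprob {1..n} p ?B1 \<le> exp (- (real r1 * real s1 / 2) * (1 + ln z))"
      using s1 z1 by (intro bprob_stars) auto
    also have "\<dots> = exp (- (real r1 * real s1 / 2 * (1 + L / 8)))" by (simp add: lnz)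
    also have "\<dots> \<le> exp (- R t / (64 * E))"
    proof (rule final)
      have "sqrt t * sqrt t \<le> (real r1 * real s1) * (4 * real k ^ 4) * real s0"
        using r1(2) t by (simp add: a1_def mult_ac)
      also have "\<dots> \<le> (real r1 * real s1) * (4 * real k ^ 4) * (2 * (B * sqrt t))"
        using s0(3) by (intro mult_left_mono) auto
      finally have "sqrt t * sqrt t \<le> (real r1 * real s1) * (8 * (real k ^ 4 * B)) * sqrt t"
        by (simp add: mult_ac)
      then have "sqrt t \<le> (real r1 * real s1) * (8 * (real k ^ 4 * B))"
        using t by (simp only: mult_le_cancel_right) (auto simp: not_less)
      then have "sqrt t / (8 * (real k ^ 4 * B)) \<le> real r1 * real s1"
        using k4B by (subst pos_divide_le_eq) auto
      then have "sqrt t / (8 * (real k ^ 4 * B)) / 2 * (L / 8) \<le> real r1 * real s1 / 2 * (1 + L / 8)"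
        using L_pos t k4B by (intro mult_mono divide_right_mono) auto
      then show "sqrt t * L / (128 * (real k ^ 4 * B)) \<le> real r1 * real s1 / 2 * (1 + L / 8)"
        by simp
    qed
    finally show ?thesis .
  qed
  \<comment> \<open>Stars of size about \<open>B * m\<close> allow only \<open>\<rho> = 1\<close>
    and give no logarithm. Instead \<open>r2 * s2\<close> is at least of order
    \<open>t / s1\<close>, that is \<open>sqrt t * z\<close>, and
    \<open>z \<ge> L / 8\<close>.\<close>
  have P2: "bprob {1..n} p ?B2 \<le> exp (- R t / (64 * E))"
  proof -
    have "bprob {1..n} p ?B2 \<le> exp (- (real r2 * real s2 / 2) * (1 + ln 1))"
      using s2 by (intro bprob_stars) auto
    also have "\<dots> = exp (- (real r2 * real s2 / 2))" by simp
    also have "\<dots> \<le> exp (- R t / (64 * E))"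
    proof (rule final)
      have "sqrt t * sqrt t \<le> (real r2 * real s2) * (4 * real k ^ 4) * real s1"
        using r2(2) t by (simp add: a2_def mult_ac)
      also have "\<dots> \<le> (real r2 * real s2) * (4 * real k ^ 4) * (2 * (B * (sqrt t / z)))"
        using s1(3) by (intro mult_left_mono) auto
      finally have "sqrt t * sqrt t \<le> (real r2 * real s2) * (8 * (real k ^ 4 * B)) / z * sqrt t"
        by (simp add: mult_ac)
      then have "sqrt t \<le> (real r2 * real s2) * (8 * (real k ^ 4 * B)) / z"
        using t by (simp only: mult_le_cancel_right) (auto simp: not_less)
      then have "sqrt t * z \<le> (real r2 * real s2) * (8 * (real k ^ 4 * B))"
        using z1 by (simp add: pos_le_divide_eq)
      moreover have "sqrt t * (L / 8) \<le> sqrt t * z" using zL t by (intro mult_left_mono) auto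
      ultimately have "sqrt t * (L / 8) \<le> (real r2 * real s2) * (8 * (real k ^ 4 * B))" by linarith
      then have "sqrt t * (L / 8) / (8 * (real k ^ 4 * B)) \<le> real r2 * real s2"
        using k4B by (subst pos_divide_le_eq) auto
      then show "sqrt t * L / (128 * (real k ^ 4 * B)) \<le> real r2 * real s2 / 2" by (simp add: mult_ac)
    qed
    finally show ?thesis .
  qed
  let ?Bad = "\<lambda>A. ?B0 A \<or> ?B1 A \<or> ?B2 A"
  have "bprob {1..n} p (\<lambda>A. edge_count H A \<ge> \<mu> + t)
      \<le> bprob {1..n} p ?Bad + exp (1 - R t / (64 * real k * E\<^sup>2))"
  proof (rule bprob_upper_aux[OF t s2(3)])
    fix A assume ok: "\<not> ?Bad A"
    have finJ0: "finite (?J0 A)" using H_simps(1) by simp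
    \<comment> \<open>With \<open>r = 1\<close> nothing is deleted; this use only extracts a degree
      bound from the absence of stars of size \<open>s0\<close>.\<close>
    have "\<exists>J\<subseteq>?J0 A. card (?J0 A - J) \<le> (1 - 1) * (k * s0) * card H
        \<and> (\<forall>v. card {e \<in> J. v \<in> e} \<le> k * s0 * (k * k))"
      using H_simps(1) ok by (intro reduce_H card_mono) auto
    then obtain J where J: "J \<subseteq> ?J0 A" "card (?J0 A - J) \<le> (1 - 1) * (k * s0) * card H"
      "\<forall>v. card {e \<in> J. v \<in> e} \<le> k * s0 * (k * k)" by (elim exE conjE)
    have "finite (?J0 A - J)" using finJ0 by (rule finite_Diff)
    moreover have "card (?J0 A - J) = 0" using J(2) by (simp only: diff_self_eq_0 mult_0 le_0_eq)
    ultimately have "?J0 A - J = {}" by (simp only: card_0_eq)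
    then have J0: "J = ?J0 A" using J(1) by blast
    have d0: "card {e \<in> ?J0 A. v \<in> e} \<le> k * s0 * (k * k)" for v
      using J(3) unfolding J0 by (rule spec)
    have "\<exists>J1\<subseteq>?J0 A. card (?J0 A - J1) \<le> (r1 - 1) * (k * s1) * (k * s0 * (k * k))
        \<and> (\<forall>v. card {e \<in> J1. v \<in> e} \<le> k * s1 * (k * k))"
      using ok d0 by (intro reduce_H) auto
    then obtain J1 where J1: "J1 \<subseteq> ?J0 A" "card (?J0 A - J1) \<le> (r1 - 1) * (k * s1) * (k * s0 * (k * k))"
      "\<forall>v. card {e \<in> J1. v \<in> e} \<le> k * s1 * (k * k)" by (elim exE conjE)
    have "no_stars s2 r2 (?J0 A)" using ok by (simp only: de_Morgan_disj not_not)
    then have none: "no_stars s2 r2 J1" using J1(1) by (rule no_stars_subset)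
    have "\<exists>J2\<subseteq>J1. card (J1 - J2) \<le> (r2 - 1) * (k * s2) * (k * s1 * (k * k))
        \<and> (\<forall>v. card {e \<in> J2. v \<in> e} \<le> k * s2 * (k * k))"
    proof (rule reduce_H[OF _ none])
      show "J1 \<subseteq> H" using J1(1) by (rule order_trans) (rule Collect_restrict)
    qed (use J1(3) in simp)
    then obtain J2 where J2: "J2 \<subseteq> J1" "card (J1 - J2) \<le> (r2 - 1) * (k * s2) * (k * s1 * (k * k))"
      "\<forall>v. card {e \<in> J2. v \<in> e} \<le> k * s2 * (k * k)" by (elim exE conjE)
    have "card (?J0 A - J2) \<le> card ((?J0 A - J1) \<union> (J1 - J2))"
      using finJ0 finite_subset[OF J1(1) finJ0] by (intro card_mono) auto
    also have "\<dots> \<le> card (?J0 A - J1) + card (J1 - J2)" by (rule card_Un_le)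
    also have "\<dots> \<le> (r1 - 1) * (k * s1) * (k * s0 * (k * k)) + (r2 - 1) * (k * s2) * (k * s1 * (k * k))"
      using J1(2) J2(2) by (rule add_mono)
    finally have "real (card (?J0 A - J2)) \<le> real ((r1 - 1) * (k * s1) * (k * s0 * (k * k))
        + (r2 - 1) * (k * s2) * (k * s1 * (k * k)))" by (rule of_nat_mono)
    also have "\<dots> = real (r1 - 1) * a1 / 4 + real (r2 - 1) * a2 / 4"
      by (simp add: a1_def a2_def power4_eq_xxxx mult_ac)
    also have "\<dots> \<le> t / 2" using r1(1) r2(1) by linarith
    finally show "\<exists>J\<subseteq>?J0 A. real (card (?J0 A - J)) \<le> t / 2
        \<and> (\<forall>v. card {e \<in> J. v \<in> e} \<le> k * s2 * (k * k))"
      using subset_trans[OF J2(1) J1(1)] J2(3) by (intro exI[of _ J2] conjI)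
  qed
  moreover have "bprob {1..n} p ?Bad \<le> bprob {1..n} p ?B0 + (bprob {1..n} p ?B1 + bprob {1..n} p ?B2)"
    using p0 p1 by (intro order_trans[OF bprob_disj] add_left_mono bprob_disj) auto
  ultimately show ?thesis using P0 P1 P2 by linarith
qed

text \<open>In \<open>65536 = 64 * 256 * 4\<close> the factors come from the low-degree tail, from
  comparing \<open>V2\<close> with \<open>m * Y\<close>, and from trading the leading constant 6 for
  a quarter of the exponent.\<close>

lemma bprob_upper:
  assumes \<gamma>: "0 < \<gamma>" "p \<le> 1 - \<gamma>" and t: "sqrt V2 \<le> t"
  shows "bprob {1..n} p (\<lambda>A. edge_count H A \<ge> \<mu> + t)
    \<le> exp (- (\<gamma> / (65536 * (real k)\<^sup>2 * E\<^sup>2)) * min (t\<^sup>2 / V2) (sqrt t * L))"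
proof -
  let ?P = "bprob {1..n} p (\<lambda>A. edge_count H A \<ge> \<mu> + t)"
  define a where "a = 1 / (64 * real k * E\<^sup>2)"
  define \<Psi> where "\<Psi> = min (t\<^sup>2 / V2) (sqrt t * L)"
  have k1: "1 \<le> real k" using k3 by simp
  have t0: "0 < t" using t V2_pos by (meson less_le_trans real_sqrt_gt_zero)
  have t2: "V2 \<le> t\<^sup>2" using t by (rule sqrt_le_D)
  have R0: "0 \<le> R t" by (rule R_nonneg[OF t0])
  have kE: "64 * E \<le> 64 * real k * E\<^sup>2"
  proof -
    have "1 * E * 1 \<le> real k * E * E" using k1 E_ge by (intro mult_mono) auto
    then show ?thesis by (simp add: power2_eq_square)
  qed
  have a0: "0 < a" using k1 E_ge by (simp add: a_def)
  have a1: "a \<le> 1 / (64 * E)"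
    unfolding a_def using kE E_ge k1 by (intro divide_left_mono mult_pos_pos) auto
  have "1 / (64 * E) \<le> 1" using E_ge by simp
  then have a2: "a \<le> 1" using a1 by linarith
  have "exp (1 - a * R t) = exp 1 * exp (- (a * R t))" by (simp flip: exp_add)
  also have "\<dots> \<le> 3 * exp (- (a * R t))" by (intro mult_right_mono exp_le) simp
  finally have e1: "exp (1 - a * R t) \<le> 3 * exp (- (a * R t))" .
  have aR: "R t / (64 * real k * E\<^sup>2) = a * R t" by (simp add: a_def)
  have P6: "?P \<le> 6 * exp (- (a * R t))"
  proof (cases "t\<^sup>2 \<le> m\<^sup>2 * Y")
    case True
    have "exp (- R t) \<le> exp (- (a * R t))" using mult_right_mono[OF a2 R0] by simp
    then show ?thesis using bprob_upper_small[OF t0 True] e1 exp_ge_zero[of "- (a * R t)"] unfolding aR by linarith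
  next
    case False
    have "exp (- R t / (64 * E)) \<le> exp (- (a * R t))" using mult_right_mono[OF a1 R0] by simp
    then show ?thesis using bprob_upper_large[OF t0] False e1 unfolding aR by linarith
  qed
  have \<gamma>1: "1 \<le> 256 * real k / \<gamma>" using \<gamma> p0 k1 by (simp add: field_simps)
  have "\<gamma> * (m * Y) \<le> (1 - p) * (m * Y)" using \<gamma> mY_ge_1 by (intro mult_right_mono) auto
  then have "\<gamma> * (m * Y) \<le> 256 * real k * V2" using V2_lower by linarith
  then have mYV: "m * Y \<le> 256 * real k / \<gamma> * V2" using \<gamma> by (simp add: field_simps)
  have "t\<^sup>2 / V2 \<le> 256 * real k / \<gamma> * (t\<^sup>2 / (m * Y))"
  proof -
    have "t\<^sup>2 * (m * Y) \<le> t\<^sup>2 * (256 * real k / \<gamma> * V2)" by (intro mult_left_mono mYV) auto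
    then have "t\<^sup>2 * (m * Y) / (m * Y) / V2 \<le> t\<^sup>2 * (256 * real k / \<gamma> * V2) / (m * Y) / V2"
      using V2_pos mY_ge_1 by (intro divide_right_mono) auto
    moreover have "t\<^sup>2 * (m * Y) / (m * Y) / V2 = t\<^sup>2 / V2" using m_ge_1 Y_pos by simp
    moreover have "t\<^sup>2 * (256 * real k / \<gamma> * V2) / (m * Y) / V2 = 256 * real k / \<gamma> * (t\<^sup>2 / (m * Y))"
      using V2_pos by simp
    ultimately show ?thesis by (simp only:)
  qed
  moreover have "1 * (sqrt t * L) \<le> 256 * real k / \<gamma> * (sqrt t * L)"
    using \<gamma>1 t0 L_pos by (intro mult_right_mono) auto
  ultimately have \<Psi>R: "\<Psi> \<le> 256 * real k / \<gamma> * R t"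
    unfolding \<Psi>_def R_def by (auto simp only: min_def split: if_splits)
  define x where "x = a * \<gamma> / (256 * real k) * \<Psi>"
  have \<Psi>0: "0 \<le> \<Psi>" using t0 L_pos V2_pos by (simp add: \<Psi>_def)
  have x0: "0 \<le> x" using a0 \<gamma> k1 \<Psi>0 by (simp add: x_def)
  have "x \<le> a * \<gamma> / (256 * real k) * (256 * real k / \<gamma> * R t)"
    unfolding x_def using a0 \<gamma> k1 by (intro mult_left_mono \<Psi>R) auto
  also have "\<dots> = a * R t" using \<gamma> k1 by simp
  finally have "exp (- (a * R t)) \<le> exp (- x)" by simp
  then have "?P \<le> 6 * exp (- x)" using P6 by linarith
  moreover have "?P \<le> 1 / 2"
    by (rule bprob_Cantelli_upper[of "{1..n}" p t "edge_count H", unfolded bexp_H bexp_H_var])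
       (use p0 p1 t0 t2 in auto)
  ultimately have "?P \<le> exp (- x / 4)" using x0 by (intro le_exp_if_le_half) auto
  also have "- x / 4 = - (\<gamma> / (65536 * (real k)\<^sup>2 * E\<^sup>2)) * \<Psi>"
    by (simp add: x_def a_def power2_eq_square)
  finally show ?thesis unfolding \<Psi>_def .
qed

lemma bprob_lower:
  assumes \<gamma>: "0 < \<gamma>" "p \<le> 1 - \<gamma>" and t: "sqrt V2 \<le> t" and max: "\<mu> + t \<le> real (card H)"
    and \<tau>: "\<tau> = sqrt (sqrt (\<gamma> / (256 * real k)))"
    and K1: "K1 = sqrt (32 * real k / \<gamma>) + 2 * real k / \<tau>"
    and K2: "K2 = 1 + sqrt (2 * real k ^ 4 * 4 ^ k * (256 * real k / \<gamma>))"
    and C1: "C1 = 2 * K1 + 1 / (\<gamma> * \<tau>)"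
    and C2: "C2 = 512 * real k ^ 6 * K2\<^sup>2 / \<gamma> + 2"
    and C3: "C3 = 4 * real k ^ 4 * (16 * real k / (\<gamma> / K2))\<^sup>2"
  shows "exp (- (C1 * (1 + C3) + C2) * min (t\<^sup>2 / V2) (sqrt t * L))
    \<le> bprob {1..n} p (\<lambda>A. edge_count H A \<ge> \<mu> + t)" (is "_ \<le> ?P")
proof -
  define x where "x = t\<^sup>2 / V2"
  define y where "y = sqrt t * L"
  have t0: "0 < t" using t V2_pos by (meson less_le_trans real_sqrt_gt_zero)
  have xy: "0 \<le> x" "0 \<le> y" using t0 V2_pos L_pos by (auto simp: x_def y_def)
  have \<tau>0: "0 \<le> \<tau>" using \<gamma> by (simp add: \<tau>)
  have K1': "0 \<le> K1" using \<gamma> \<tau>0 by (simp add: K1)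
  have K2': "1 \<le> K2" using \<gamma> by (simp add: K2)
  have C: "0 \<le> C1" "0 \<le> C2" "0 \<le> C3" using \<gamma> \<tau>0 K1' by (auto simp: C1 C2 C3)
  have y: "exp (- C1 * y) \<le> ?P"
    unfolding C1 y_def by (rule bprob_lower_clique[OF \<gamma> t max \<tau> K1])
  \<comment> \<open>Planting covers every case in which \<open>y\<close> is at most a constant times
    the minimum; tilting is left with \<open>x < y\<close> and
    \<open>K2 * t \<le> \<gamma> * \<mu>\<close>.\<close>
  have "x \<le> y \<and> exp (- C2 * x) \<le> ?P \<or> y \<le> (1 + C3) * min x y"
  proof (cases "y \<le> x")
    case True
    then show ?thesis using C xy by (simp add: min_absorb2 mult_right_mono[of 1 "1 + C3" y, simplified])
  next
    case yx: False
    show ?thesis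
    proof (cases "K2 * t \<le> \<gamma> * \<mu>")
      case True
      then show ?thesis using bprob_lower_tilt[OF \<gamma> t K2 True] yx unfolding C2 x_def by simp
    next
      case False
      have \<epsilon>: "0 < \<gamma> / K2" "\<gamma> / K2 \<le> 1" "\<gamma> / K2 * \<mu> \<le> t"
        using \<gamma> K2' p0 False by (auto simp: field_simps)
      have "y \<le> C3 * x" unfolding C3 x_def y_def by (rule rate_min_large_t[OF \<epsilon>])
      moreover have "min x y = x" using yx by simp
      ultimately show ?thesis using xy by (simp add: distrib_right)
    qed
  qed
  then have "exp (- (C1 * (1 + C3) + C2) * min x y) \<le> ?P"
  proof (elim disjE conjE)
    assume xle: "x \<le> y" and P: "exp (- C2 * x) \<le> ?P"
    have "0 \<le> C1 * (1 + C3) * x" using C xy by simp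
    then have "exp (- (C1 * (1 + C3) + C2) * x) \<le> exp (- C2 * x)" by (simp add: algebra_simps)
    then show ?thesis using P unfolding min_absorb1[OF xle] by (rule order_trans)
  next
    assume "y \<le> (1 + C3) * min x y"
    then have "C1 * y \<le> C1 * ((1 + C3) * min x y)" using C by (intro mult_left_mono) auto
    moreover have "0 \<le> C2 * min x y" using C xy by simp
    ultimately have "- (C1 * (1 + C3) + C2) * min x y \<le> - C1 * y" by (simp add: algebra_simps)
    then have "exp (- (C1 * (1 + C3) + C2) * min x y) \<le> exp (- C1 * y)" by simp
    then show ?thesis using y by linarith
  qed
  then show ?thesis by (simp only: x_def y_def)
qed

section \<open>Identification with the mean, variance and tail of the progression count\<close>

lemma mean_AP_eq: "mean_AP k n p = \<mu>"
proof -
  have "mean_AP k n p = bexp {1..n} p (num_AP k)"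
    unfolding mean_AP_def using p0 p1 by (intro expectation_random_subset) auto
  also have "\<dots> = bexp {1..n} p (edge_count H)" by (intro bexp_cong num_AP_edge_count)
  finally show ?thesis by (simp only: bexp_H)
qed

lemma var_AP_eq: "var_AP k n p = V2"
proof -
  have "var_AP k n p = bexp {1..n} p (\<lambda>A. (num_AP k A - mean_AP k n p)\<^sup>2)"
    unfolding var_AP_def mean_AP_def[symmetric] using p0 p1
    by (intro expectation_random_subset) auto
  also have "\<dots> = bexp {1..n} p (\<lambda>A. (edge_count H A - \<mu>)\<^sup>2)"
    unfolding mean_AP_eq
    by (intro bexp_cong arg_cong2[of _ _ _ _ "\<lambda>x y. (x - y)\<^sup>2"] num_AP_edge_count refl)
  finally show ?thesis by (simp only: bexp_H_var)
qed

lemma prob_AP_eq: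
  "measure_pmf.prob (random_subset n p) {A. num_AP k A \<ge> x} = bprob {1..n} p (\<lambda>A. edge_count H A \<ge> x)"
proof -
  have "measure_pmf.prob (random_subset n p) {A. num_AP k A \<ge> x} = bprob {1..n} p (\<lambda>A. num_AP k A \<ge> x)"
    using p0 p1 by (intro prob_random_subset) auto
  also have "\<dots> = bprob {1..n} p (\<lambda>A. edge_count H A \<ge> x)"
    by (intro bexp_cong) (simp only: num_AP_edge_count)
  finally show ?thesis .
qed

end

lemma powr_threshold:
  fixes k n :: nat and p :: real
  assumes k: "2 \<le> k" and n: "1 < n" and p: "0 < p"
    and le: "ln (real n) powr (1 / (real k - 1)) * real n powr (- 1 / (real k - 1)) \<le> p"
  shows "ln (real n) \<le> real n * p ^ (k - 1)"
proof -
  have k1: "real (k - 1) = real k - 1" "real k - 1 \<noteq> 0" using k by auto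
  have ln0: "0 < ln (real n)" using n by simp
  have "(ln (real n) powr (1 / (real k - 1)) * real n powr (- 1 / (real k - 1))) powr real (k - 1)
      \<le> p powr real (k - 1)"
    using le by (intro powr_mono2) auto
  moreover have "(ln (real n) powr (1 / (real k - 1)) * real n powr (- 1 / (real k - 1))) powr real (k - 1)
      = ln (real n) * real n powr (- 1)"
    using k1 ln0 n by (simp add: powr_mult powr_powr)
  ultimately have "ln (real n) / real n \<le> p ^ (k - 1)"
    using p n by (simp add: powr_realpow powr_minus_divide)
  then show ?thesis using n by (simp add: field_simps)
qed

theorem theorem1p3:
  fixes k :: nat
  assumes "k \<ge> 3"
  shows "\<exists>n0::nat. n0 > 0 \<and> (\<forall>\<gamma>::real. 0 < \<gamma> \<and> \<gamma> < 1 \<longrightarrow>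
    (\<exists>(c::real) (C::real). c > 0 \<and> C > 0 \<and>
      (\<forall>(n::nat) (p::real) (t::real).
        n \<ge> n0 \<and> 0 < p \<and> p \<le> 1 \<and>
        ln (real n) powr (1 / (real k - 1)) * real n powr (- 1 / (real k - 1)) \<le> p \<and>
        p \<le> 1 - \<gamma> \<and> t \<ge> sqrt (var_AP k n p) \<longrightarrow>
        of_bool (mean_AP k n p + t \<le> num_AP k {1..n}) * exp (- C * rate_AP k n p t)
          \<le> measure_pmf.prob (random_subset n p) {A. num_AP k A \<ge> mean_AP k n p + t} \<and>
        measure_pmf.prob (random_subset n p) {A. num_AP k A \<ge> mean_AP k n p + t}
          \<le> exp (- c * rate_AP k n p t))))"
\<comment> \<open>From \<open>n \<ge> 2 * k\<close> on, \<open>card_arith_progs_ge\<close> gives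
  quadratically many progressions.\<close>
proof (rule exI[of _ "2 * k"], intro conjI allI impI, goal_cases)
  case 1
  show ?case using assms by simp
next
  case (2 \<gamma>)
  then have \<gamma>: "0 < \<gamma>" by simp
  \<comment> \<open>The constants must be fixed before \<open>n\<close> and \<open>p\<close>, hence
    outside the locale; \<open>E0\<close> is \<open>E\<close> written out, which depends on
    \<open>k\<close> only.\<close>
  define E0 where "E0 = 2 * real k ^ 4 * (real k * exp 2)"
  define c where "c = \<gamma> / (65536 * (real k)\<^sup>2 * E0\<^sup>2)"
  define \<tau> where "\<tau> = sqrt (sqrt (\<gamma> / (256 * real k)))"
  define K1 where "K1 = sqrt (32 * real k / \<gamma>) + 2 * real k / \<tau>"
  define K2 where "K2 = 1 + sqrt (2 * real k ^ 4 * 4 ^ k * (256 * real k / \<gamma>))"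
  define C1 where "C1 = 2 * K1 + 1 / (\<gamma> * \<tau>)"
  define C2 where "C2 = 512 * real k ^ 6 * K2\<^sup>2 / \<gamma> + 2"
  define C3 where "C3 = 4 * real k ^ 4 * (16 * real k / (\<gamma> / K2))\<^sup>2"
  define C where "C = C1 * (1 + C3) + C2"
  have c0: "0 < c" using \<gamma> assms by (simp add: c_def E0_def)
  have "0 \<le> C1" "0 \<le> C3" using \<gamma> by (auto simp: C1_def K1_def \<tau>_def C3_def)
  moreover have "0 < C2" using \<gamma> by (auto simp: C2_def intro!: add_nonneg_pos)
  ultimately have C0: "0 < C" by (auto simp: C_def intro!: add_nonneg_pos)
  have main: "of_bool (mean_AP k n p + t \<le> num_AP k {1..n}) * exp (- C * rate_AP k n p t)
          \<le> measure_pmf.prob (random_subset n p) {A. num_AP k A \<ge> mean_AP k n p + t} \<and>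
        measure_pmf.prob (random_subset n p) {A. num_AP k A \<ge> mean_AP k n p + t}
          \<le> exp (- c * rate_AP k n p t)"
    if n: "2 * k \<le> n" and p: "0 < p" "p \<le> 1 - \<gamma>"
      and th: "ln (real n) powr (1 / (real k - 1)) * real n powr (- 1 / (real k - 1)) \<le> p"
      and t: "sqrt (var_AP k n p) \<le> t" for n p t
  proof -
    interpret random_APs k n p
    proof
      show "ln (real n) \<le> real n * p ^ (k - 1)"
        using assms n p th by (intro powr_threshold) auto
    qed (use assms n p \<gamma> in auto)
    have rate: "rate_AP k n p t = min (t\<^sup>2 / V2) (sqrt t * L)"
      by (simp only: rate_AP_def var_AP_eq L_def)
    have N: "num_AP k {1..n} = real (card H)" by (simp only: num_AP_def)
    have t': "sqrt V2 \<le> t" using t by (simp only: var_AP_eq)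
    have "of_bool (\<mu> + t \<le> real (card H)) * exp (- C * min (t\<^sup>2 / V2) (sqrt t * L))
        \<le> bprob {1..n} p (\<lambda>A. edge_count H A \<ge> \<mu> + t)"
    proof (cases "\<mu> + t \<le> real (card H)")
      case True
      then show ?thesis
        using bprob_lower[OF \<gamma> p(2) t' True \<tau>_def K1_def K2_def C1_def C2_def C3_def]
        by (simp only: C_def of_bool_eq mult_1)
    next
      case False
      have "0 \<le> bprob {1..n} p (\<lambda>A. edge_count H A \<ge> \<mu> + t)"
        using p0 p1 by (intro bprob_nonneg) auto
      then show ?thesis using False by (simp only: of_bool_eq mult_zero_left)
    qed
    moreover have "bprob {1..n} p (\<lambda>A. edge_count H A \<ge> \<mu> + t)
        \<le> exp (- c * min (t\<^sup>2 / V2) (sqrt t * L))"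
      using bprob_upper[OF \<gamma> p(2) t'] by (simp only: c_def E0_def E_def B_def)
    ultimately show ?thesis unfolding rate N prob_AP_eq mean_AP_eq by (rule conjI)
  qed
  show ?case
    by (rule exI[of _ c], rule exI[of _ C], intro conjI c0 C0 allI impI; elim conjE;
        rule main[THEN conjunct1] main[THEN conjunct2]; assumption)
qed

end
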